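(* There is an absolute constant $K>0$ such that the following holds. Let $p\in\mathbb{F}_2[T]$ be monic and irreducible of degree $d\geq 3$, and suppose that the set of roots of $p$ in $\overline{\mathbb{F}}_2$ is not closed under inversion. Let $m\geq 1$, put $n=dm$, and let $S$ be the conjugacy class in $\mathrm{GL}_n(2)$ of the block-diagonal matrix $C(p)^{\oplus m}$ formed from $m$ copies of the companion matrix $C(p)$. Then $$\left|\frac{\log|S|}{\log|\mathrm{GL}_n(2)|}-\Bigl(1-\frac1d\Bigr)\right|\leq K n^{-2},$$ and $$S^2\cap\{x\in\mathrm{GL}_n(2):\operatorname{supp}(x)<m\}=\varnothing,$$ where $S^2=\{ab: a,b\in S\}$.
   Context: $\mathrm{GL}_n(q)$ denotes the general linear group over the finite field $\mathbb{F}_q$; $\mathrm{GL}_n(2)=\mathrm{PSL}_n(2)$. $C(f)$ denotes the companion matrix of a monic polynomial $f$. For $g\in\mathrm{GL}_n(q)$, the support is $\operatorname{supp}(g):=\min_{\lambda\in\overline{\mathbb{F}}_q^{\times}}\operatorname{rank}(g-\lambda I)$, i.e. the codimension of a largest eigenspace over the algebraic closure. *)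

theory Defs
  imports
    Complex_Main
    "HOL-Library.Z2"
    "HOL-Algebra.Coset"
    "HOL-Algebra.Algebraic_Closure_Type"
    "Jordan_Normal_Form.DL_Rank"
begin

text \<open>The field with two elements is the type \<^typ>\<open>bit\<close>, and \<^typ>\<open>'a alg_closure\<close> is an
  algebraic closure of \<^typ>\<open>'a\<close>, with embedding \<^const>\<open>to_ac\<close>.\<close>

definition GL :: "'a::field itself \<Rightarrow> nat \<Rightarrow> 'a mat monoid" where
  "GL ty n = units_of (ring_mat ty n ())"

definition conj_class :: "('a, 'b) monoid_scheme \<Rightarrow> 'a \<Rightarrow> 'a set" where
  "conj_class G x = {h \<otimes>\<^bsub>G\<^esub> x \<otimes>\<^bsub>G\<^esub> inv\<^bsub>G\<^esub> h | h. h \<in> carrier G}"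

text \<open>Convention: ones on the subdiagonal, and the negated non-leading coefficients of the (monic)
  polynomial in the last column.\<close>

definition companion_mat :: "'a::field poly \<Rightarrow> 'a mat" where
  "companion_mat f = mat (degree f) (degree f)
     (\<lambda>(i, j). if j = degree f - 1 then - coeff f i else if i = j + 1 then 1 else 0)"

definition ac_roots :: "'a::field poly \<Rightarrow> 'a alg_closure set" where
  "ac_roots f = {a. poly (map_poly to_ac f) a = 0}"

text \<open>The infimum is that of a nonempty set of natural numbers, hence a minimum.\<close>

definition mat_supp :: "'a::field mat \<Rightarrow> nat" where
  "mat_supp g = (INF c \<in> {c :: 'a alg_closure. c \<noteq> 0}.
     vec_space.rank (dim_row g) (map_mat to_ac g - c \<cdot>\<^sub>m 1\<^sub>m (dim_row g)))"

end

theory Submission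
  imports
    Defs
    "Jordan_Normal_Form.Char_Poly"
    "HOL-Library.Cardinality"
begin

text \<open>Write \<open>s\<close> for the block matrix and \<open>\<beta>\<close> for a root of \<open>p\<close>. The rows \<open>(1, \<beta>, \<dots>, \<beta>\<^sup>d\<^sup>-\<^sup>1)\<close>,
  placed blockwise, form an \<open>m \<times> dm\<close> matrix \<open>E\<close> with \<open>E s = \<beta> E\<close>, and the relation \<open>E Y = M E\<close>
  identifies the centralizer of \<open>s\<close> with the invertible \<open>m \<times> m\<close> matrices \<open>M\<close> over
  \<open>F\<^sub>2(\<beta>)\<close>, a field with \<open>2\<^sup>d\<close> elements. Since invertible \<open>m \<times> m\<close> matrices make up at least
  a quarter of all matrices over any finite field, the orders of the group and of the centralizer
  are \<open>2\<close> to the powers \<open>n\<^sup>2\<close> and \<open>n\<^sup>2/d\<close> up to a factor 4, which gives the first claim.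

  If \<open>x = a b\<close> has support below \<open>m\<close>, its large eigenspace has dimension above \<open>n/2\<close>, so the
  eigenvalue is fixed by Frobenius and equals 1. The eigenspace then meets the \<open>m\<close>-dimensional
  \<open>\<beta>\<close>-eigenspace of \<open>a\<close>, and a common vector is a \<open>1/\<beta>\<close>-eigenvector of \<open>b\<close>; so \<open>1/\<beta>\<close> is a
  root of \<open>p\<close> for every root \<open>\<beta>\<close>.\<close>

section \<open>Counting matrices over a finite subfield\<close>

text \<open>Every factor grows with \<open>q\<close>, so the case of base 2 is the worst one; there
  the product stays above 1/4 by an induction with a surplus term.\<close>

lemma prod_one_minus_power_ge:
  fixes q :: real
  assumes "q \<ge> 2"
  shows "(\<Prod>j=1..m. 1 - 1 / q ^ j) \<ge> 1 / 4"
proof -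
  \<comment> \<open>The bound 1/4 alone is not inductive. With surplus \<open>e\<close>, the next
    factor \<open>1 - e\<close> still leaves 1/4 plus half the surplus because e \<le> 1/4; the
    induction starts from 1/2 = 1/4 + 1/4.\<close>
  have "(\<Prod>j=1..Suc m. 1 - (1/2::real) ^ j) \<ge> 1/4 + (1/2) ^ (m + 2)" for m
  proof (induction m)
    case (Suc m)
    define e :: real where "e = (1/2) ^ (m + 2)"
    have "(1/2::real) ^ (m + 2) \<le> (1/2) ^ 2" by (intro power_decreasing) auto
    then have e: "0 < e" "e \<le> 1/4"
      by (simp_all add: e_def power2_eq_square)
    have "e * e \<le> (1/4) * e" using e by (intro mult_right_mono) auto
    moreover have "(1/4 + e) * (1 - e) = 1/4 + 3/4 * e - e * e"
      by (simp add: distrib_left distrib_right right_diff_distrib)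
    ultimately have "1/4 + e / 2 \<le> (1/4 + e) * (1 - e)" using e by linarith
    also have "\<dots> \<le> (\<Prod>j=1..Suc m. 1 - (1/2::real) ^ j) * (1 - e)"
      using Suc e by (intro mult_right_mono) (auto simp: e_def)
    also have "\<dots> = (\<Prod>j=1..Suc (Suc m). 1 - (1/2::real) ^ j)"
      by (simp add: e_def)
    finally show ?case by (simp add: e_def)
  qed auto
  then have half: "(\<Prod>j=1..m. 1 - (1/2::real) ^ j) \<ge> 1/4"
  proof (cases m)
    case (Suc k)
    have "(\<Prod>j=1..Suc k. 1 - (1/2::real) ^ j) \<ge> 1/4 + (1/2) ^ (k + 2)" by fact
    moreover have "(1/2::real) ^ (k + 2) \<ge> 0" by simp
    ultimately show ?thesis unfolding Suc by linarith
  qed auto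
  also have "(\<Prod>j=1..m. 1 - (1/2::real) ^ j) \<le> (\<Prod>j=1..m. 1 - 1 / q ^ j)"
  proof (rule prod_mono)
    fix j assume j: "j \<in> {1..m}"
    have "(2::real) ^ j \<le> q ^ j" using assms by (intro power_mono) auto
    then have "1 / q ^ j \<le> (1/2) ^ j"
      by (simp add: power_one_over frac_le)
    moreover have "(1/2::real) ^ j \<le> 1" by (intro power_le_one) auto
    ultimately show "0 \<le> 1 - (1/2::real) ^ j \<and> 1 - (1/2) ^ j \<le> 1 - 1 / q ^ j" by auto
  qed
  finally show ?thesis .
qed

text \<open>A field given as a subset of a larger one: this covers the field generated by a root
  inside the algebraic closure, and also the full base field when the set is
  \<open>UNIV\<close>.\<close>

locale finite_subfield =
  fixes K :: "'a::field set"
  assumes finite_K: "finite K"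
    and zero_closed: "0 \<in> K" and one_closed: "1 \<in> K"
    and add_closed: "\<And>x y. x \<in> K \<Longrightarrow> y \<in> K \<Longrightarrow> x + y \<in> K"
    and minus_closed: "\<And>x. x \<in> K \<Longrightarrow> - x \<in> K"
    and mult_closed: "\<And>x y. x \<in> K \<Longrightarrow> y \<in> K \<Longrightarrow> x * y \<in> K"
    and inverse_closed: "\<And>x. x \<in> K \<Longrightarrow> inverse x \<in> K"
begin

lemma card_ge_2: "card K \<ge> 2"
proof -
  have "card {0, 1 :: 'a} \<le> card K"
    using finite_K zero_closed one_closed by (intro card_mono) auto
  then show ?thesis by simp
qed

definition mats :: "nat \<Rightarrow> nat \<Rightarrow> 'a mat set" where
  "mats r c = {M \<in> carrier_mat r c. \<forall>i<r. \<forall>j<c. M $$ (i, j) \<in> K}"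

text \<open>Invertibility over \<open>K\<close> in the form of independent columns. The coefficients
  range over \<open>K\<close> only, which is what counting tuples delivers and what the centralizer
  argument consumes.\<close>

definition inj_mats :: "nat \<Rightarrow> 'a mat set" where
  "inj_mats m = {M \<in> mats m m. \<forall>c. (\<forall>i<m. c i \<in> K) \<longrightarrow>
     (\<forall>r<m. (\<Sum>i<m. c i * M $$ (r, i)) = 0) \<longrightarrow> (\<forall>i<m. c i = 0)}"

lemma bij_betw_mats:
  "bij_betw (\<lambda>v. mat r c (\<lambda>(i, j). v (i, j))) (({..<r} \<times> {..<c}) \<rightarrow>\<^sub>E K) (mats r c)"
proof (rule bij_betwI[where g = "\<lambda>M. restrict (\<lambda>(i, j). M $$ (i, j)) ({..<r} \<times> {..<c})"])
  show "(\<lambda>v. mat r c (\<lambda>(i, j). v (i, j))) \<in> (({..<r} \<times> {..<c}) \<rightarrow>\<^sub>E K) \<rightarrow> mats r c"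
    by (auto simp: mats_def PiE_def Pi_def)
qed (auto simp: mats_def PiE_def Pi_def extensional_def fun_eq_iff restrict_def)

lemma finite_mats: "finite (mats r c)"
  using bij_betw_finite[OF bij_betw_mats[of r c]] finite_K by (simp add: finite_PiE)

lemma card_mats: "card (mats r c) = card K ^ (r * c)"
  using bij_betw_same_card[OF bij_betw_mats[of r c]]
  by (simp add: card_PiE card_cartesian_product)

section \<open>Counting independent tuples of vectors over \<open>K\<close>\<close>

definition vecs :: "nat \<Rightarrow> (nat \<Rightarrow> 'a) set" where
  "vecs m = {..<m} \<rightarrow>\<^sub>E K"

definition indep :: "nat \<Rightarrow> nat \<Rightarrow> (nat \<Rightarrow> nat \<Rightarrow> 'a) \<Rightarrow> bool" where
  "indep m k v \<longleftrightarrow> (\<forall>c \<in> {..<k} \<rightarrow> K. (\<forall>r<m. (\<Sum>i<k. c i * v i r) = 0) \<longrightarrow> (\<forall>i<k. c i = 0))"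

definition indeps :: "nat \<Rightarrow> nat \<Rightarrow> (nat \<Rightarrow> nat \<Rightarrow> 'a) set" where
  "indeps m k = {v \<in> {..<k} \<rightarrow>\<^sub>E vecs m. indep m k v}"

definition comb_span :: "nat \<Rightarrow> nat \<Rightarrow> (nat \<Rightarrow> nat \<Rightarrow> 'a) \<Rightarrow> (nat \<Rightarrow> 'a) set" where
  "comb_span m k v = (\<lambda>c. restrict (\<lambda>r. \<Sum>i<k. c i * v i r) {..<m}) ` ({..<k} \<rightarrow>\<^sub>E K)"

lemma finite_vecs: "finite (vecs m)" and card_vecs: "card (vecs m) = card K ^ m"
  using finite_K by (auto simp: vecs_def finite_PiE card_PiE)

lemma finite_indeps: "finite (indeps m k)"
  using finite_vecs finite_PiE[of "{..<k}" "\<lambda>_. vecs m"] by (simp add: indeps_def)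

lemma card_comb_span: "finite (comb_span m k v)" "card (comb_span m k v) \<le> card K ^ k"
proof -
  have "finite ({..<k} \<rightarrow>\<^sub>E K)" "card ({..<k} \<rightarrow>\<^sub>E K) = card K ^ k"
    using finite_K by (auto simp: finite_PiE card_PiE)
  then show "finite (comb_span m k v)" "card (comb_span m k v) \<le> card K ^ k"
    unfolding comb_span_def using card_image_le by fastforce+
qed

lemma indep_extend:
  assumes v: "indep m k v" and w: "w \<in> vecs m" "w \<notin> comb_span m k v"
  shows "indep m (Suc k) (v(k := w))"
  unfolding indep_def
proof (intro ballI impI)
  fix c assume c: "c \<in> {..<Suc k} \<rightarrow> K"
    and "\<forall>r<m. (\<Sum>i<Suc k. c i * (v(k := w)) i r) = 0"
  then have sum: "(\<Sum>i<k. c i * v i r) + c k * w r = 0" if "r < m" for r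
  proof -
    have "(\<Sum>i<k. c i * (v(k := w)) i r) = (\<Sum>i<k. c i * v i r)"
      by (intro sum.cong) auto
    then show ?thesis
      using \<open>\<forall>r<m. (\<Sum>i<Suc k. c i * (v(k := w)) i r) = 0\<close> that by simp
  qed
  have "c k = 0"
  proof (rule ccontr)
    assume ck: "c k \<noteq> 0"
    define c' where "c' = restrict (\<lambda>i. - inverse (c k) * c i) {..<k}"
    have "c' \<in> {..<k} \<rightarrow>\<^sub>E K"
      using c by (auto simp: c'_def intro!: mult_closed minus_closed inverse_closed)
    moreover have "w = restrict (\<lambda>r. \<Sum>i<k. c' i * v i r) {..<m}"
    proof
      fix r
      show "w r = restrict (\<lambda>r. \<Sum>i<k. c' i * v i r) {..<m} r"
      proof (cases "r < m")
        case True
        have "(\<Sum>i<k. c' i * v i r) = - inverse (c k) * (\<Sum>i<k. c i * v i r)"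
          by (simp add: c'_def sum_distrib_left mult.assoc sum_negf)
        also have "\<dots> = w r" using sum[OF True] ck
          by (simp add: add_eq_0_iff field_simps)
        finally show ?thesis using True by simp
      qed (use w in \<open>auto simp: vecs_def\<close>)
    qed
    ultimately show False using w(2) by (auto simp: comb_span_def)
  qed
  moreover from this have "\<forall>i<k. c i = 0"
    using v c sum unfolding indep_def by (auto simp: Pi_def)
  ultimately show "\<forall>i<Suc k. c i = 0" by (auto simp: less_Suc_eq)
qed

text \<open>An independent tuple can be extended by any vector outside its span, and the span has at
  most \<open>card K ^ k\<close> elements. For k \<ge> m the truncated difference is 0.\<close>

lemma card_indeps_Suc:
  "card (indeps m k) * (card K ^ m - card K ^ k) \<le> card (indeps m (Suc k))"
proof -
  let ?A = "SIGMA v : indeps m k. vecs m - comb_span m k v"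
  have "inj_on (\<lambda>(v, w). v(k := w)) ?A"
  proof (rule inj_onI, clarify)
    fix v w v' w'
    assume v: "v \<in> indeps m k" "v' \<in> indeps m k" and eq: "v(k := w) = v'(k := w')"
    have "v i = v' i" for i
    proof (cases "i = k")
      case True
      \<comment> \<open>Tuples are extensional, so both have the same default value at index
        \<open>k\<close>, and overwriting that position loses no information.\<close>
      have "v k = undefined" "v' k = undefined" using v by (auto simp: indeps_def PiE_def extensional_def)
      then show ?thesis using True by simp
    next
      case False
      then show ?thesis using fun_cong[OF eq, of i] by simp
    qed
    then show "v = v' \<and> w = w'" using fun_cong[OF eq, of k] by auto
  qed
  moreover have "(\<lambda>(v, w). v(k := w)) ` ?A \<subseteq> indeps m (Suc k)"
  proof clarify
    fix v w assume v: "v \<in> indeps m k" and w: "w \<in> vecs m" "w \<notin> comb_span m k v"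
    have "v(k := w) \<in> {..<Suc k} \<rightarrow>\<^sub>E vecs m"
      using v w by (auto simp: indeps_def PiE_def Pi_def extensional_def less_Suc_eq)
    then show "v(k := w) \<in> indeps m (Suc k)"
      using indep_extend[OF _ w] v by (auto simp: indeps_def)
  qed
  ultimately have "card ?A \<le> card (indeps m (Suc k))"
    by (rule card_inj_on_le) (rule finite_indeps)
  moreover have "card ?A = (\<Sum>v\<in>indeps m k. card (vecs m - comb_span m k v))"
    using finite_indeps finite_vecs by (intro card_SigmaI) auto
  moreover have "\<dots> \<ge> (\<Sum>v\<in>indeps m k. card K ^ m - card K ^ k)"
  proof (rule sum_mono)
    fix v
    have "card K ^ m - card K ^ k \<le> card (vecs m) - card (comb_span m k v)"
      using card_comb_span[of m k v] by (simp add: card_vecs)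
    also have "\<dots> \<le> card (vecs m - comb_span m k v)"
      using card_comb_span[of m k v] by (intro diff_card_le_card_Diff) auto
    finally show "card K ^ m - card K ^ k \<le> card (vecs m - comb_span m k v)" .
  qed
  ultimately show ?thesis by simp
qed

lemma card_indeps_ge: "(\<Prod>j<k. card K ^ m - card K ^ j) \<le> card (indeps m k)"
proof (induction k)
  case 0
  have "(\<lambda>_. undefined) \<in> indeps m 0" by (auto simp: indeps_def indep_def)
  then show ?case using finite_indeps[of m 0] by (auto simp: Suc_le_eq card_gt_0_iff)
next
  case (Suc k)
  then show ?case
    using order_trans[OF mult_le_mono1[OF Suc] card_indeps_Suc[of m k]] by simp
qed

text \<open>Independent \<open>m\<close>-tuples, written as columns, are injective matrices. Pulling
  \<open>?q ^ m\<close> out of each of the \<open>m\<close> factors leaves the product bounded by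
  1/4, in reverse order.\<close>

lemma card_inj_mats_ge: "real (card (inj_mats m)) \<ge> real (card K) ^ (m * m) / 4"
proof -
  let ?q = "real (card K)"
  have q: "?q \<ge> 2" using card_ge_2 by simp
  let ?f = "\<lambda>v. mat m m (\<lambda>(r, i). v i r)"
  have "inj_on ?f (indeps m m)"
  proof (rule inj_onI)
    fix v w assume v: "v \<in> indeps m m" "w \<in> indeps m m" and eq: "?f v = ?f w"
    have "v i r = w i r" if "i < m" "r < m" for i r
      using arg_cong[OF eq, of "\<lambda>M. M $$ (r, i)"] that by simp
    moreover have "v i r = w i r" if "i < m" "\<not> r < m" for i r
      using v that by (auto simp: indeps_def PiE_def Pi_def vecs_def extensional_def)
    moreover have "v i r = w i r" if "\<not> i < m" for i r
      using v that by (auto simp: indeps_def PiE_def extensional_def)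
    ultimately show "v = w" by (intro ext) blast
  qed
  moreover have "?f ` indeps m m \<subseteq> inj_mats m"
  proof clarify
    fix v assume "v \<in> indeps m m"
    then have v: "v \<in> {..<m} \<rightarrow>\<^sub>E vecs m" "indep m m v" by (auto simp: indeps_def)
    show "?f v \<in> inj_mats m"
      unfolding inj_mats_def
    proof (intro CollectI conjI allI impI)
      show "?f v \<in> mats m m"
        using v by (auto simp: mats_def PiE_def Pi_def vecs_def)
      fix c i assume c: "\<forall>i<m. c i \<in> K" "\<forall>r<m. (\<Sum>i<m. c i * ?f v $$ (r, i)) = 0" "i < m"
      have "(\<Sum>i<m. c i * v i r) = 0" if "r < m" for r
      proof -
        have "(\<Sum>i<m. c i * v i r) = (\<Sum>i<m. c i * ?f v $$ (r, i))"
          using that by (intro sum.cong) auto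
        then show ?thesis using c(2) that by simp
      qed
      then show "c i = 0" using v(2) c(1,3) by (auto simp: indep_def Pi_def)
    qed
  qed
  moreover have "finite (inj_mats m)"
    using finite_mats by (simp add: inj_mats_def)
  ultimately have "card (indeps m m) \<le> card (inj_mats m)" by (intro card_inj_on_le)
  then have "real (\<Prod>j<m. card K ^ m - card K ^ j) \<le> real (card (inj_mats m))"
    using card_indeps_ge[of m m] by linarith
  moreover have "real (\<Prod>j<m. card K ^ m - card K ^ j) = (\<Prod>j<m. ?q ^ m * (1 - 1 / ?q ^ (m - j)))"
    unfolding of_nat_prod
  proof (rule prod.cong)
    fix j assume "j \<in> {..<m}"
    then have j: "j < m" by simp
    have "real (card K ^ m - card K ^ j) = ?q ^ m - ?q ^ j"
      using j card_ge_2 by (subst of_nat_diff) (auto intro!: power_increasing)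
    also have "?q ^ j = ?q ^ m / ?q ^ (m - j)"
      using j q by (subst power_diff) auto
    finally show "real (card K ^ m - card K ^ j) = ?q ^ m * (1 - 1 / ?q ^ (m - j))"
      by (simp add: algebra_simps)
  qed simp
  moreover have "(\<Prod>j<m. ?q ^ m * (1 - 1 / ?q ^ (m - j))) = ?q ^ (m * m) * (\<Prod>j=1..m. 1 - 1 / ?q ^ j)"
  proof -
    have "(\<Prod>j<m. 1 - 1 / ?q ^ (m - j)) = (\<Prod>j=1..m. 1 - 1 / ?q ^ j)"
      by (rule prod.reindex_bij_witness[of _ "\<lambda>j. m - j" "\<lambda>j. m - j"]) auto
    then show ?thesis by (simp add: prod.distrib power_mult)
  qed
  moreover have "?q ^ (m * m) * (1/4) \<le> ?q ^ (m * m) * (\<Prod>j=1..m. 1 - 1 / ?q ^ j)"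
    using prod_one_minus_power_ge[OF q] by (intro mult_left_mono) auto
  ultimately show ?thesis by simp
qed

end

section \<open>Eigenrows of a block companion matrix\<close>

text \<open>Fixes the indexing convention: position \<open>k\<close> lies in block
  \<open>k div d\<close> at offset \<open>k mod d\<close>.\<close>

lemma sum_blocks:
  fixes f :: "nat \<Rightarrow> 'a::comm_monoid_add"
  shows "(\<Sum>k<d * m. f k) = (\<Sum>i<m. \<Sum>j<d. f (d * i + j))"
proof -
  have "(\<Sum>j<d. f (d * i + j)) = sum f {i * d..<i * d + d}" for i
    using sum.shift_bounds_nat_ivl[of f 0 "d * i" d]
    by (simp add: atLeast0LessThan add.commute mult.commute)
  then show ?thesis by (simp add: sum.nat_group mult.commute)
qed

lemma block_index_lt: "i < m \<Longrightarrow> j < d \<Longrightarrow> d * i + j < d * (m::nat)"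
  by (metis add.commute add_less_cancel_left less_le_trans mult_Suc_right mult_le_mono2 Suc_leI)

lemma div_block_lt: "k < d * m \<Longrightarrow> k div d < (m::nat)"
  by (simp add: less_mult_imp_div_less mult.commute)

lemma diag_block_mat_replicate:
  assumes A: "A \<in> carrier_mat d d"
  shows "diag_block_mat (replicate m A) \<in> carrier_mat (d * m) (d * m)"
    and "\<And>k l. k < d * m \<Longrightarrow> l < d * m \<Longrightarrow> diag_block_mat (replicate m A) $$ (k, l) =
      (if k div d = l div d then A $$ (k mod d, l mod d) else 0)"
proof (induction m)
  case (Suc m)
  let ?B = "diag_block_mat (replicate m A)"
  have B: "?B \<in> carrier_mat (d * m) (d * m)" by (fact Suc)
  have eq: "diag_block_mat (replicate (Suc m) A) =
      four_block_mat A (0\<^sub>m d (d * m)) (0\<^sub>m (d * m) d) ?B"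
    using A B by (simp add: Let_def)
  {
    case 1
    show ?case unfolding eq using four_block_carrier_mat[OF A B] by simp
  next
    case (2 k l)
    have d: "d > 0" using 2 by (auto intro: Nat.gr0I)
    have shift: "(x - d) div d = x div d - 1" "(x - d) mod d = x mod d" "x div d > 0" if "x \<ge> d" for x
      using that d by (auto simp: le_mod_geq le_div_geq)
    show ?case
      unfolding eq using A B 2 Suc(2)[of "k - d" "l - d"] shift[of k] shift[of l]
      by (auto simp: div_eq_0_iff)
  }
qed auto

lemma companion_mat_carrier: "companion_mat q \<in> carrier_mat (degree q) (degree q)"
  by (simp add: companion_mat_def)

context
  fixes q :: "'a::field poly" and d m :: nat and B :: "'a mat"
  assumes monic: "lead_coeff q = 1" and deg: "degree q = d" and d_pos: "d > 0"
  defines "B \<equiv> diag_block_mat (replicate m (companion_mat q))"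
begin

lemma block_companion_carrier: "B \<in> carrier_mat (d * m) (d * m)"
  unfolding B_def using diag_block_mat_replicate(1) companion_mat_carrier[of q] deg by blast

text \<open>With ones on the subdiagonal, a row multiplied from the left is shifted by one place
  within each block; only the last column of a block sees the coefficients of \<open>q\<close>. This
  is why row eigenvectors are used.\<close>

lemma row_mult_block_companion:
  assumes l: "l < d * m"
  shows "(\<Sum>k<d * m. u k * B $$ (k, l)) =
    (if Suc (l mod d) = d then - (\<Sum>j<d. coeff q j * u (d * (l div d) + j)) else u (Suc l))"
proof -
  let ?i = "l div d" and ?t = "l mod d"
  have t: "?t < d" using d_pos by simp
  have i: "?i < m" using l by (rule div_block_lt)
  have "(\<Sum>k<d * m. u k * B $$ (k, l)) = (\<Sum>i<m. \<Sum>j<d. u (d * i + j) * B $$ (d * i + j, l))"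
    by (rule sum_blocks)
  also have "\<dots> = (\<Sum>i<m. if i = ?i then \<Sum>j<d. u (d * i + j) * companion_mat q $$ (j, ?t) else 0)"
  proof (rule sum.cong)
    fix i assume "i \<in> {..<m}"
    then have "B $$ (d * i + j, l) = (if i = ?i then companion_mat q $$ (j, ?t) else 0)" if "j < d" for j
      unfolding B_def using that l deg companion_mat_carrier[of q]
      by (subst diag_block_mat_replicate(2)[of _ d]) (auto simp: block_index_lt)
    then show "(\<Sum>j<d. u (d * i + j) * B $$ (d * i + j, l)) =
      (if i = ?i then \<Sum>j<d. u (d * i + j) * companion_mat q $$ (j, ?t) else 0)"
      by (auto intro!: sum.cong sum.neutral)
  qed simp
  also have "\<dots> = (\<Sum>j<d. u (d * ?i + j) * companion_mat q $$ (j, ?t))"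
    using i by simp
  also have "\<dots> = (\<Sum>j<d. if Suc ?t = d then - (coeff q j * u (d * ?i + j))
      else if j = Suc ?t then u (d * ?i + j) else 0)"
    using t deg by (intro sum.cong) (auto simp: companion_mat_def)
  also have "\<dots> = (if Suc ?t = d then - (\<Sum>j<d. coeff q j * u (d * ?i + j)) else u (Suc l))"
    using t by (auto simp: sum_negf)
  finally show ?thesis .
qed

lemma poly_monic_expand: "poly q x = (\<Sum>j<d. coeff q j * x ^ j) + x ^ d"
proof -
  have "poly q x = (\<Sum>j<Suc d. coeff q j * x ^ j)"
    by (simp add: poly_altdef deg lessThan_Suc_atMost)
  then show ?thesis using monic deg by simp
qed

text \<open>The shifting columns force a geometric progression with ratio \<mu> inside each block.
  The last column of the block then says that \<open>poly q \<mu>\<close> times the first entry of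
  the block vanishes.\<close>

lemma block_companion_eigenrowD:
  assumes eig: "\<And>l. l < d * m \<Longrightarrow> (\<Sum>k<d * m. u k * B $$ (k, l)) = \<mu> * u l"
  shows "\<And>k. k < d * m \<Longrightarrow> u k = \<mu> ^ (k mod d) * u (d * (k div d))"
    and "\<And>k. k < d * m \<Longrightarrow> u k \<noteq> 0 \<Longrightarrow> poly q \<mu> = 0"
proof -
  have pow: "u (d * i + j) = \<mu> ^ j * u (d * i)" if "i < m" "j < d" for i j
    using that(2)
  proof (induction j)
    case (Suc j)
    have "\<mu> * u (d * i + j) = u (Suc (d * i + j))"
      using eig[of "d * i + j"] row_mult_block_companion[of "d * i + j" u] Suc.prems that(1)
      by (simp add: block_index_lt)
    then show ?case using Suc by (simp add: mult.assoc)
  qed simp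
  show 1: "u k = \<mu> ^ (k mod d) * u (d * (k div d))" if "k < d * m" for k
    using pow[of "k div d" "k mod d"] that d_pos by (simp add: div_block_lt)
  fix k assume k: "k < d * m" "u k \<noteq> 0"
  define i where "i = k div d"
  have i: "i < m" "u (d * i) \<noteq> 0" using 1[OF k(1)] k by (auto simp: i_def div_block_lt)
  \<comment> \<open>Offset of the last column of a block, the only one where the polynomial
    enters.\<close>
  define t where "t = d - 1"
  have t: "t < d" "Suc t = d" using d_pos by (auto simp: t_def)
  let ?l = "d * i + t"
  have l: "?l < d * m" "?l div d = i" "Suc (?l mod d) = d"
    using i t by (auto intro!: block_index_lt)
  have "\<mu> * u ?l = - (\<Sum>j<d. coeff q j * u (d * i + j))"
    using eig[OF l(1)] row_mult_block_companion[OF l(1), of u] l(2,3) by simp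
  also have "\<dots> = - (\<Sum>j<d. coeff q j * \<mu> ^ j) * u (d * i)"
    using pow[OF i(1)] by (simp add: sum_distrib_right mult.assoc)
  also have "\<mu> * u ?l = \<mu> ^ d * u (d * i)"
    using pow[OF i(1) t(1)] t(2) by (simp add: mult.assoc flip: power_Suc)
  finally have "poly q \<mu> * u (d * i) = 0"
    by (simp add: poly_monic_expand distrib_right)
  then show "poly q \<mu> = 0" using i by simp
qed

text \<open>Conversely, a root allows one free scalar \<open>w i\<close> per block, so its row
  eigenspace has dimension \<open>m\<close>.\<close>

lemma block_companion_eigenrowI:
  assumes root: "poly q \<beta> = 0" and l: "l < d * m"
  shows "(\<Sum>k<d * m. (\<beta> ^ (k mod d) * w (k div d)) * B $$ (k, l)) = \<beta> * (\<beta> ^ (l mod d) * w (l div d))"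
proof -
  have t: "l mod d < d" using d_pos by simp
  have pd: "(\<Sum>j<d. coeff q j * \<beta> ^ j) = - (\<beta> ^ d)"
    using root poly_monic_expand[of \<beta>] by (simp add: eq_neg_iff_add_eq_0)
  show ?thesis
  proof (cases "Suc (l mod d) = d")
    case True
    have "(\<Sum>j<d. coeff q j * (\<beta> ^ ((d * (l div d) + j) mod d) * w ((d * (l div d) + j) div d))) =
        (\<Sum>j<d. coeff q j * \<beta> ^ j) * w (l div d)"
      by (simp add: sum_distrib_right mult.assoc)
    then show ?thesis
      unfolding row_mult_block_companion[OF l] pd using True
      by (simp add: mult.assoc[symmetric] flip: power_Suc)
  next
    case False
    then have "Suc (l mod d) < d" using t by linarith
    then have "Suc l mod d = Suc (l mod d)" "Suc l div d = l div d"
      by (simp_all add: mod_Suc div_Suc)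
    then show ?thesis
      unfolding row_mult_block_companion[OF l] using False by simp
  qed
qed

end

text \<open>For a root \<beta> of the polynomial, the rows form a basis of the row eigenspace of the
  block companion matrix for \<beta>.\<close>

definition eigenrows :: "nat \<Rightarrow> nat \<Rightarrow> 'a::field \<Rightarrow> 'a mat" where
  "eigenrows d m \<beta> = mat m (d * m) (\<lambda>(i, k). if k div d = i then \<beta> ^ (k mod d) else 0)"

lemma eigenrows_carrier [simp]: "eigenrows d m \<beta> \<in> carrier_mat m (d * m)"
  by (simp add: eigenrows_def)

lemma mult_eigenrows_index:
  assumes M: "M \<in> carrier_mat r m" and i: "i < r" and k: "k < d * m"
  shows "(M * eigenrows d m \<beta>) $$ (i, k) = M $$ (i, k div d) * \<beta> ^ (k mod d)"
proof -
  have "(M * eigenrows d m \<beta>) $$ (i, k) =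
      (\<Sum>t = 0..<m. M $$ (i, t) * (if k div d = t then \<beta> ^ (k mod d) else 0))"
    using assms by (simp add: scalar_prod_def eigenrows_def)
  also have "\<dots> = (\<Sum>t = 0..<m. if t = k div d then M $$ (i, t) * \<beta> ^ (k mod d) else 0)"
    by (intro sum.cong) auto
  also have "\<dots> = M $$ (i, k div d) * \<beta> ^ (k mod d)"
    using div_block_lt[OF k] by simp
  finally show ?thesis .
qed

lemma eigenrows_mult_index:
  assumes Y: "Y \<in> carrier_mat (d * m) c" and i: "i < m" and l: "l < c"
  shows "(eigenrows d m \<beta> * Y) $$ (i, l) = (\<Sum>j<d. \<beta> ^ j * Y $$ (d * i + j, l))"
proof -
  have "(eigenrows d m \<beta> * Y) $$ (i, l) =
      (\<Sum>k<d * m. (if k div d = i then \<beta> ^ (k mod d) else 0) * Y $$ (k, l))"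
    using assms by (simp add: scalar_prod_def eigenrows_def atLeast0LessThan)
  also have "\<dots> = (\<Sum>t<m. \<Sum>j<d. (if t = i then \<beta> ^ j else 0) * Y $$ (d * t + j, l))"
    unfolding sum_blocks by (intro sum.cong) auto
  also have "\<dots> = (\<Sum>t<m. if t = i then \<Sum>j<d. \<beta> ^ j * Y $$ (d * t + j, l) else 0)"
    by (intro sum.cong) auto
  also have "\<dots> = (\<Sum>j<d. \<beta> ^ j * Y $$ (d * i + j, l))" using i by simp
  finally show ?thesis .
qed

lemma mat_mult_index_lessThan:
  "A \<in> carrier_mat r n \<Longrightarrow> B \<in> carrier_mat n c \<Longrightarrow> i < r \<Longrightarrow> l < c \<Longrightarrow>
    (A * B) $$ (i, l) = (\<Sum>k<n. A $$ (i, k) * B $$ (k, l))"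
  by (simp add: scalar_prod_def atLeast0LessThan)

context
  fixes q :: "'a::field poly" and d m :: nat and B :: "'a mat"
  assumes monic: "lead_coeff q = 1" and deg: "degree q = d" and d_pos: "d > 0"
  defines "B \<equiv> diag_block_mat (replicate m (companion_mat q))"
begin

lemma eigenrows_mult_block_companion:
  assumes "poly q \<beta> = 0"
  shows "eigenrows d m \<beta> * B = \<beta> \<cdot>\<^sub>m eigenrows d m \<beta>"
proof (rule eq_matI)
  note B = block_companion_carrier[OF monic deg d_pos, of m, folded B_def]
  fix i l assume "i < dim_row (\<beta> \<cdot>\<^sub>m eigenrows d m \<beta>)" "l < dim_col (\<beta> \<cdot>\<^sub>m eigenrows d m \<beta>)"
  then have il: "i < m" "l < d * m" by (auto simp: eigenrows_def)
  have "(eigenrows d m \<beta> * B) $$ (i, l) =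
      (\<Sum>k<d * m. (\<beta> ^ (k mod d) * (if k div d = i then 1 else 0)) * B $$ (k, l))"
    unfolding mat_mult_index_lessThan[OF eigenrows_carrier B il]
    using il by (intro sum.cong) (auto simp: eigenrows_def)
  also have "\<dots> = \<beta> * (\<beta> ^ (l mod d) * (if l div d = i then 1 else 0))"
    unfolding B_def by (rule block_companion_eigenrowI[OF monic deg d_pos assms il(2)])
  also have "\<dots> = (\<beta> \<cdot>\<^sub>m eigenrows d m \<beta>) $$ (i, l)"
    using il by (simp add: eigenrows_def)
  finally show "(eigenrows d m \<beta> * B) $$ (i, l) = (\<beta> \<cdot>\<^sub>m eigenrows d m \<beta>) $$ (i, l)" .
qed (use block_companion_carrier[OF monic deg d_pos, of m, folded B_def] in \<open>auto simp: eigenrows_def\<close>)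

text \<open>Row by row, an eigenmatrix is determined by its entries at the block starts
  \<open>d * t\<close>, where the power of \<mu> is 1. These entries are the coefficients with
  respect to \<open>eigenrows\<close>.\<close>

lemma block_companion_eigenmat:
  assumes U: "U \<in> carrier_mat r (d * m)" and eig: "U * B = \<mu> \<cdot>\<^sub>m U"
  shows "U = mat r m (\<lambda>(i, t). U $$ (i, d * t)) * eigenrows d m \<mu>"
    and "U \<noteq> 0\<^sub>m r (d * m) \<Longrightarrow> poly q \<mu> = 0"
proof -
  note B = block_companion_carrier[OF monic deg d_pos, of m, folded B_def]
  have row: "(\<Sum>k<d * m. U $$ (i, k) * B $$ (k, l)) = \<mu> * U $$ (i, l)" if "i < r" "l < d * m" for i l
    using arg_cong[OF eig, of "\<lambda>A. A $$ (i, l)"] mat_mult_index_lessThan[OF U B that] U that by simp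
  note D = block_companion_eigenrowD[OF monic deg d_pos, of m, folded B_def, OF row]
  show "U = mat r m (\<lambda>(i, t). U $$ (i, d * t)) * eigenrows d m \<mu>"
    (is "_ = ?M * _")
  proof (rule eq_matI)
    fix i k assume "i < dim_row (?M * eigenrows d m \<mu>)" "k < dim_col (?M * eigenrows d m \<mu>)"
    then have ik: "i < r" "k < d * m" by (auto simp: eigenrows_def)
    have "?M \<in> carrier_mat r m" by simp
    from mult_eigenrows_index[OF this ik]
    show "U $$ (i, k) = (?M * eigenrows d m \<mu>) $$ (i, k)"
      using D(1)[OF ik(1) _ ik(2)] ik by (simp add: div_block_lt)
  qed (use U in \<open>auto simp: eigenrows_def\<close>)
  assume "U \<noteq> 0\<^sub>m r (d * m)"
  then obtain i k where "i < r" "k < d * m" "U $$ (i, k) \<noteq> 0"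
    using U by (metis carrier_matD eq_matI index_zero_mat)
  then show "poly q \<mu> = 0" using D(2) by blast
qed

end

interpretation to_ac: field_hom "to_ac :: 'a::field \<Rightarrow> 'a alg_closure"
  by unfold_locales auto

lemma map_block_companion:
  fixes p :: "'a::field poly"
  shows "map_mat to_ac (diag_block_mat (replicate m (companion_mat p))) =
    diag_block_mat (replicate m (companion_mat (map_poly to_ac p)))"
proof -
  have deg: "degree (map_poly to_ac p) = degree p" by (rule degree_map_poly) simp
  have eq: "map_mat to_ac (companion_mat p) = companion_mat (map_poly to_ac p)"
    by (rule eq_matI) (auto simp: companion_mat_def deg coeff_map_poly)
  let ?C = "companion_mat p"
  have C: "?C \<in> carrier_mat (degree p) (degree p)"
    "map_mat to_ac ?C \<in> carrier_mat (degree p) (degree p)"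
    by (simp_all add: companion_mat_carrier)
  note D = diag_block_mat_replicate[OF C(1), where m = m] and D' = diag_block_mat_replicate[OF C(2), where m = m]
  show ?thesis
    unfolding eq[symmetric]
  proof (rule eq_matI)
    fix k l assume "k < dim_row (diag_block_mat (replicate m (map_mat to_ac ?C)))"
      and "l < dim_col (diag_block_mat (replicate m (map_mat to_ac ?C)))"
    then have kl: "k < degree p * m" "l < degree p * m" using D'(1) by auto
    then have "degree p > 0" by (auto intro: Nat.gr0I)
    then have "k mod degree p < degree p" "l mod degree p < degree p" by auto
    then show "map_mat to_ac (diag_block_mat (replicate m ?C)) $$ (k, l) =
        diag_block_mat (replicate m (map_mat to_ac ?C)) $$ (k, l)"
      using kl C D(1) D(2)[OF kl] D'(2)[OF kl] by auto
  qed (use D(1) D'(1) in auto)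
qed

section \<open>The centralizer of a block companion matrix\<close>

text \<open>Links membership in the unit group to the injectivity used in counting; the direction
  from injectivity goes through the determinant.\<close>

lemma units_ring_mat_iff_injective:
  fixes A :: "'a::field mat"
  assumes A: "A \<in> carrier_mat n n"
  shows "A \<in> Units (ring_mat TYPE('a) n ()) \<longleftrightarrow>
    (\<forall>v \<in> carrier_vec n. A *\<^sub>v v = 0\<^sub>v n \<longrightarrow> v = 0\<^sub>v n)"
proof
  assume "A \<in> Units (ring_mat TYPE('a) n ())"
  then obtain A' where A': "A' \<in> carrier_mat n n" "A' * A = 1\<^sub>m n"
    by (auto simp: Units_def ring_mat_simps)
  show "\<forall>v \<in> carrier_vec n. A *\<^sub>v v = 0\<^sub>v n \<longrightarrow> v = 0\<^sub>v n"
  proof (intro ballI impI)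
    fix v assume v: "v \<in> carrier_vec n" "A *\<^sub>v v = 0\<^sub>v n"
    have "v = (A' * A) *\<^sub>v v" using v A' by simp
    also have "\<dots> = 0\<^sub>v n" using v A A' by (subst assoc_mult_mat_vec) auto
    finally show "v = 0\<^sub>v n" .
  qed
next
  assume "\<forall>v \<in> carrier_vec n. A *\<^sub>v v = 0\<^sub>v n \<longrightarrow> v = 0\<^sub>v n"
  then have "det A \<noteq> 0" using det_0_iff_vec_prod_zero_field[OF A] by auto
  then show "A \<in> Units (ring_mat TYPE('a) n ())" by (rule det_non_zero_imp_unit[OF A])
qed

interpretation to_ac_poly: map_poly_inj_idom_hom "to_ac :: 'a::field \<Rightarrow> 'a alg_closure"
  by unfold_locales

section \<open>The finite field generated by a root of an irreducible polynomial\<close>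

locale irreducible_root =
  fixes p :: "'a::{field, finite} poly" and \<beta> :: "'a alg_closure" and d :: nat
  assumes irr: "irreducible p" and deg: "degree p = d" and root: "poly (map_poly to_ac p) \<beta> = 0"
begin

definition eval_root :: "'a poly \<Rightarrow> 'a alg_closure" where
  "eval_root f = poly (map_poly to_ac f) \<beta>"

lemma eval_root_simps [simp]:
  "eval_root 0 = 0" "eval_root 1 = 1" "eval_root p = 0"
  "eval_root (f + g) = eval_root f + eval_root g"
  "eval_root (f * g) = eval_root f * eval_root g"
  "eval_root (- f) = - eval_root f"
  "eval_root (f - g) = eval_root f - eval_root g"
  using root by (simp_all add: eval_root_def to_ac_poly.hom_add to_ac_poly.hom_mult
      to_ac_poly.hom_uminus to_ac_poly.hom_minus)

lemma eval_root_mod: "eval_root (f mod g) = eval_root f" if "eval_root g = 0"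
proof -
  have "eval_root (f div g * g + f mod g) = eval_root (f mod g)"
    by (simp only: eval_root_simps that mult_zero_right add_0_left)
  then show ?thesis by simp
qed

text \<open>The powers of \<beta> below \<open>d\<close> are linearly independent over the base
  field. A nonzero polynomial of least degree vanishing at \<beta> divides \<open>p\<close>; it is
  not a unit, so \<open>p\<close> divides it and its degree is at least \<open>d\<close>.\<close>

lemma eval_root_eq_0:
  assumes f: "eval_root f = 0" "degree f < d"
  shows "f = 0"
proof (rule ccontr)
  assume "f \<noteq> 0"
  define P where "P g \<longleftrightarrow> g \<noteq> 0 \<and> eval_root g = 0" for g
  obtain g where g: "P g" "\<And>h. P h \<Longrightarrow> degree g \<le> degree h"
    using arg_min_natI[of P f degree] arg_min_nat_le[of P _ degree] f \<open>f \<noteq> 0\<close>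
    unfolding P_def by blast
  \<comment> \<open>The remainder also vanishes at \<beta>; by minimality of \<open>g\<close> it
    must be zero.\<close>
  have "\<not> P (p mod g)"
    using g(2)[of "p mod g"] degree_mod_less'[of g p] g(1) by (force simp: P_def)
  then have "g dvd p"
    using g(1) eval_root_mod[of g p] by (auto simp: P_def dvd_eq_mod_eq_0)
  then consider "p dvd g" | "is_unit g"
    using irr by (auto dest: irreducibleD')
  then show False
  proof cases
    case 1
    then have "d \<le> degree g"
      using dvd_imp_degree_le[of p g] g(1) deg by (auto simp: P_def)
    then show False
      using g(2)[of f] f \<open>f \<noteq> 0\<close> by (auto simp: P_def)
  next
    case 2
    then obtain h where "1 = g * h" by (elim dvdE)
    then have "eval_root 1 = eval_root g * eval_root h" by (metis eval_root_simps(5))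
    then show False using g(1) by (simp add: P_def)
  qed
qed

text \<open>The field obtained by adjoining \<beta> to the base field, as the set of values of
  polynomials at \<beta>.\<close>

definition K :: "'a alg_closure set" where
  "K = range eval_root"

text \<open>The element of \<open>K\<close> whose coordinates in the basis of powers of \<beta> are
  the first \<open>d\<close> values of \<open>v\<close>.\<close>

definition comb :: "(nat \<Rightarrow> 'a) \<Rightarrow> 'a alg_closure" where
  "comb v = (\<Sum>j<d. \<beta> ^ j * to_ac (v j))"

lemma comb_eq_eval_root: "comb v = eval_root (\<Sum>j<d. monom (v j) j)"
proof -
  have "eval_root (\<Sum>j<k. monom (v j) j) = (\<Sum>j<k. \<beta> ^ j * to_ac (v j))" for k
    by (induction k) (auto simp: eval_root_def to_ac_poly.hom_add map_poly_monom poly_monom mult.commute)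
  then show ?thesis by (simp add: comb_def)
qed

lemma comb_in_K: "comb v \<in> K"
  by (simp add: comb_eq_eval_root K_def)

lemma d_pos: "d > 0"
  using irr deg by (metis gr0I irreducible_def is_unit_iff_degree)

lemma comb_eq_iff: "comb v = comb w \<longleftrightarrow> (\<forall>j<d. v j = w j)"
proof
  assume "comb v = comb w"
  then have "eval_root ((\<Sum>j<d. monom (v j) j) - (\<Sum>j<d. monom (w j) j)) = 0"
    by (simp add: comb_eq_eval_root)
  moreover have lt: "degree (\<Sum>j<d. monom (u j) j) < d" for u :: "nat \<Rightarrow> 'a"
    using d_pos by (intro degree_sum_less) (auto intro: le_less_trans[OF degree_monom_le])
  ultimately have eq: "(\<Sum>j<d. monom (v j) j) = (\<Sum>j<d. monom (w j) j)"
    using eval_root_eq_0 degree_diff_less[OF lt lt] by force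
  show "\<forall>j<d. v j = w j"
  proof (intro allI impI)
    fix j assume "j < d"
    then show "v j = w j"
      using arg_cong[OF eq, of "\<lambda>f. coeff f j"] by (simp add: coeff_sum)
  qed
qed (simp add: comb_def)

text \<open>Reducing a polynomial modulo \<open>p\<close> keeps its value at \<beta> and leaves
  \<open>d\<close> coefficients, which serve as coordinates.\<close>

lemma K_combE:
  assumes "x \<in> K"
  obtains v where "x = comb v"
proof -
  from assms obtain f where f: "x = eval_root f" by (auto simp: K_def)
  have p: "p \<noteq> 0" using irr by auto
  have "(\<Sum>j<d. monom (coeff (f mod p) j) j) = f mod p"
  proof (rule poly_eqI)
    fix i
    have "coeff (f mod p) i = 0" if "\<not> i < d"
      using degree_mod_less[OF p, of f] that deg by (auto intro: coeff_eq_0)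
    then show "coeff (\<Sum>j<d. monom (coeff (f mod p) j) j) i = coeff (f mod p) i"
      by (simp add: coeff_sum)
  qed
  then have "x = comb (coeff (f mod p))"
    by (simp add: comb_eq_eval_root f eval_root_mod)
  then show thesis by (rule that)
qed

lemma bij_betw_comb: "bij_betw comb ({..<d} \<rightarrow>\<^sub>E UNIV) K"
  unfolding bij_betw_def
proof
  show "inj_on comb ({..<d} \<rightarrow>\<^sub>E UNIV)"
    by (intro inj_onI) (auto simp: comb_eq_iff PiE_def extensional_def fun_eq_iff, metis)
  show "comb ` ({..<d} \<rightarrow>\<^sub>E UNIV) = K"
  proof (intro equalityI subsetI)
    fix x assume "x \<in> K"
    then obtain v where "x = comb v" by (rule K_combE)
    then have "x = comb (restrict v {..<d})" by (simp add: comb_eq_iff)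
    moreover have "restrict v {..<d} \<in> {..<d} \<rightarrow>\<^sub>E UNIV" by simp
    ultimately show "x \<in> comb ` ({..<d} \<rightarrow>\<^sub>E UNIV)" by (simp only: imageI)
  qed (auto intro: comb_in_K)
qed

lemma card_K: "card K = CARD('a) ^ d"
  using bij_betw_same_card[OF bij_betw_comb] by (simp add: card_PiE)

lemma finite_K: "finite K"
  using bij_betw_finite[OF bij_betw_comb] by (simp add: finite_PiE)

sublocale K: finite_subfield K
proof
  show "finite K" by (fact finite_K)
  show mult: "x * y \<in> K" if "x \<in> K" "y \<in> K" for x y
    using that unfolding K_def by (auto simp flip: eval_root_simps(5))
  show "inverse x \<in> K" if "x \<in> K" for x
  proof (cases "x = 0")
    case False
    \<comment> \<open>Inverses come from finiteness: multiplication by a nonzero element is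
      injective on \<open>K\<close>, hence onto, and so it reaches 1.\<close>
    have "inj_on (\<lambda>y. x * y) K" using False by (auto simp: inj_on_def)
    then have "(\<lambda>y. x * y) ` K = K"
      using finite_K that by (intro endo_inj_surj) (auto intro: mult)
    moreover have "1 \<in> K" by (auto simp: K_def simp flip: eval_root_simps(2))
    ultimately obtain y where "y \<in> K" "x * y = 1" by (metis imageE)
    then show ?thesis using inverse_unique[of x y] by simp
  qed (use that in simp)
  show "0 \<in> K" "1 \<in> K"
    unfolding K_def using eval_root_simps(1,2) by (metis rangeI)+
  show "x + y \<in> K" if "x \<in> K" "y \<in> K" for x y
    using that unfolding K_def by (auto simp flip: eval_root_simps(4))
  show "- x \<in> K" if "x \<in> K" for x
    using that unfolding K_def by (auto simp flip: eval_root_simps(6))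
qed

lemma root_power_in_K: "\<beta> ^ j \<in> K"
proof -
  have "\<beta> ^ j = eval_root (monom 1 j)"
    by (simp add: eval_root_def map_poly_monom poly_monom)
  then show ?thesis by (simp add: K_def)
qed

text \<open>Multiplying by the eigenrows packs each block of \<open>d\<close> base field entries of
  a column into one element of \<open>K\<close>; no information is lost, since coordinates are
  unique.\<close>

lemma eigenrows_map_index:
  assumes "Y \<in> carrier_mat (d * m) c" "i < m" "l < c"
  shows "(eigenrows d m \<beta> * map_mat to_ac Y) $$ (i, l) = comb (\<lambda>j. Y $$ (d * i + j, l))"
proof -
  have "map_mat to_ac Y \<in> carrier_mat (d * m) c" using assms by simp
  from eigenrows_mult_index[OF this assms(2,3)]
  show ?thesis using assms by (simp add: comb_def block_index_lt)
qed

lemma eigenrows_map_inj: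
  assumes Y: "Y \<in> carrier_mat (d * m) c" and Z: "Z \<in> carrier_mat (d * m) c"
    and eq: "eigenrows d m \<beta> * map_mat to_ac Y = eigenrows d m \<beta> * map_mat to_ac Z"
  shows "Y = Z"
proof (rule eq_matI)
  fix k l assume "k < dim_row Z" "l < dim_col Z"
  then have kl: "k < d * m" "l < c" using Z by auto
  have i: "k div d < m" "k mod d < d" using kl d_pos by (auto simp: div_block_lt)
  have "comb (\<lambda>j. Y $$ (d * (k div d) + j, l)) = comb (\<lambda>j. Z $$ (d * (k div d) + j, l))"
    using eigenrows_map_index[OF Y i(1) kl(2)] eigenrows_map_index[OF Z i(1) kl(2)] eq by simp
  then show "Y $$ (k, l) = Z $$ (k, l)" using i(2) unfolding comb_eq_iff by force
qed (use Y Z in auto)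

lemma mult_eigenrows_inj:
  assumes M: "M \<in> carrier_mat r m" and N: "N \<in> carrier_mat r m"
    and eq: "M * eigenrows d m \<beta> = N * eigenrows d m \<beta>"
  shows "M = N"
proof (rule eq_matI)
  fix i t assume "i < dim_row N" "t < dim_col N"
  then have it: "i < r" "t < m" "d * t < d * m" using N d_pos by auto
  show "M $$ (i, t) = N $$ (i, t)"
    using mult_eigenrows_index[OF M it(1,3), of \<beta>] mult_eigenrows_index[OF N it(1,3), of \<beta>] d_pos
    unfolding eq by simp
qed (use M N in auto)

end

section \<open>Correspondence between the centralizer and matrices over \<open>K\<close>\<close>

locale monic_irreducible_root = irreducible_root +
  fixes m :: nat
  assumes monic: "lead_coeff p = 1"
begin

definition B :: "'a mat" where
  "B = diag_block_mat (replicate m (companion_mat p))"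

definition C :: "'a mat set" where
  "C = {Y \<in> Units (ring_mat TYPE('a) (d * m) ()). Y * B = B * Y}"

abbreviation E :: "'a alg_closure mat" where
  "E \<equiv> eigenrows d m \<beta>"

lemma B_carrier: "B \<in> carrier_mat (d * m) (d * m)"
  unfolding B_def by (rule block_companion_carrier[OF monic deg d_pos])

lemma map_poly_facts:
  "lead_coeff (map_poly to_ac p) = 1" "degree (map_poly to_ac p) = d"
proof -
  show "degree (map_poly to_ac p) = d" using deg by (subst degree_map_poly) auto
  then show "lead_coeff (map_poly to_ac p) = 1" using monic deg by (simp add: coeff_map_poly)
qed

lemma map_B: "map_mat to_ac B = diag_block_mat (replicate m (companion_mat (map_poly to_ac p)))"
  unfolding B_def by (rule map_block_companion)

lemma E_map_B: "E * map_mat to_ac B = \<beta> \<cdot>\<^sub>m E"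
  unfolding map_B by (rule eigenrows_mult_block_companion[OF map_poly_facts d_pos root])

text \<open>If \<open>Y\<close> commutes with \<open>B\<close>, the rows of \<open>E\<close> times
  \<open>Y\<close> are again \<beta>-eigenrows of \<open>B\<close>, hence combinations of the rows
  of \<open>E\<close>. The coefficients are entries of \<open>E\<close> times \<open>Y\<close>, and
  these lie in \<open>K\<close> because \<open>Y\<close> has base field entries.\<close>

lemma commuting_imp_eigenrows:
  assumes Y: "Y \<in> carrier_mat (d * m) (d * m)" and comm: "Y * B = B * Y"
  shows "\<exists>M \<in> K.mats m m. E * map_mat to_ac Y = M * E"
proof -
  let ?Y = "map_mat to_ac Y" and ?B = "map_mat to_ac B"
  have c: "?Y \<in> carrier_mat (d * m) (d * m)" "?B \<in> carrier_mat (d * m) (d * m)"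
    using Y B_carrier by auto
  have U: "E * ?Y \<in> carrier_mat m (d * m)"
    by (rule mult_carrier_mat[OF eigenrows_carrier c(1)])
  have "E * ?Y * ?B = E * (?Y * ?B)" by (rule assoc_mult_mat[OF eigenrows_carrier c])
  also have "?Y * ?B = ?B * ?Y"
    using comm Y B_carrier by (simp flip: to_ac.mat_hom_mult)
  also have "E * (?B * ?Y) = E * ?B * ?Y"
    by (rule assoc_mult_mat[OF eigenrows_carrier c(2,1), symmetric])
  also have "\<dots> = \<beta> \<cdot>\<^sub>m (E * ?Y)" by (simp only: E_map_B mult_smult_assoc_mat[OF eigenrows_carrier c(1)])
  finally have eig: "E * ?Y * ?B = \<beta> \<cdot>\<^sub>m (E * ?Y)" .
  let ?M = "mat m m (\<lambda>(i, t). (E * ?Y) $$ (i, d * t))"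
  have "E * ?Y = ?M * E"
    using block_companion_eigenmat(1)[OF map_poly_facts d_pos U] eig unfolding map_B by blast
  moreover have "?M \<in> K.mats m m"
  proof -
    have "(E * ?Y) $$ (i, d * t) \<in> K" if "i < m" "t < m" for i t
      using that d_pos Y by (subst eigenrows_map_index) (auto simp: comb_in_K)
    then show ?thesis by (auto simp: K.mats_def)
  qed
  ultimately show ?thesis by blast
qed

text \<open>The matrix \<open>M\<close> attached to \<open>Y\<close> determines \<open>E\<close>
  times \<open>Y\<close> and thereby \<open>Y\<close>, so the centralizer injects into the
  \<open>m\<close> by \<open>m\<close> matrices over \<open>K\<close>.\<close>

lemma card_C_le: "card C \<le> CARD('a) ^ (d * m * m)"
proof -
  have "\<exists>f. \<forall>Y\<in>C. f Y \<in> K.mats m m \<and> E * map_mat to_ac Y = f Y * E"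
    by (intro bchoice ballI)
      (use commuting_imp_eigenrows in \<open>auto simp: C_def Units_def ring_mat_simps\<close>)
  then obtain f where f: "\<And>Y. Y \<in> C \<Longrightarrow> f Y \<in> K.mats m m"
    "\<And>Y. Y \<in> C \<Longrightarrow> E * map_mat to_ac Y = f Y * E" by blast
  have "inj_on f C"
  proof (rule inj_onI)
    fix Y Z assume "Y \<in> C" "Z \<in> C" "f Y = f Z"
    then show "Y = Z"
      using f(2)[of Y] f(2)[of Z] eigenrows_map_inj[of Y m "d * m" Z]
      by (auto simp: C_def Units_def ring_mat_simps)
  qed
  then have "card C \<le> card (K.mats m m)"
    using f(1) K.finite_mats by (intro card_inj_on_le) auto
  then show ?thesis by (simp add: K.card_mats card_K power_mult mult.assoc)
qed

text \<open>The entries of \<open>M * E\<close> lie in \<open>K\<close>, and their coordinates in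
  the power basis are the entries of the wanted \<open>Y\<close>. Commutation and invertibility of
  \<open>Y\<close> are then read off from \<open>E * ?Y = M * E\<close>.\<close>

lemma commuting_lift:
  assumes M: "M \<in> K.inj_mats m"
  shows "\<exists>Y \<in> C. E * map_mat to_ac Y = M * E"
proof -
  have MK: "M \<in> carrier_mat m m" "\<And>i j. i < m \<Longrightarrow> j < m \<Longrightarrow> M $$ (i, j) \<in> K"
    using M by (auto simp: K.inj_mats_def K.mats_def)
  have "\<exists>v. M $$ (i, l div d) * \<beta> ^ (l mod d) = comb v" if "i < m" "l < d * m" for i l
    using that MK(2)[of i "l div d"] by (meson K_combE K.mult_closed root_power_in_K div_block_lt)
  then obtain v where v: "\<And>i l. i < m \<Longrightarrow> l < d * m \<Longrightarrow> M $$ (i, l div d) * \<beta> ^ (l mod d) = comb (v i l)"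
    by metis
  define Y where "Y = mat (d * m) (d * m) (\<lambda>(k, l). v (k div d) l (k mod d))"
  have Y: "Y \<in> carrier_mat (d * m) (d * m)" by (simp add: Y_def)
  let ?Y = "map_mat to_ac Y" and ?B = "map_mat to_ac B"
  have c: "?Y \<in> carrier_mat (d * m) (d * m)" "?B \<in> carrier_mat (d * m) (d * m)"
    using Y B_carrier by auto
  have EY: "E * ?Y = M * E"
  proof (rule eq_matI)
    fix i l assume "i < dim_row (M * E)" "l < dim_col (M * E)"
    then have il: "i < m" "l < d * m" using MK by (auto simp: eigenrows_def)
    have "(E * ?Y) $$ (i, l) = comb (\<lambda>j. Y $$ (d * i + j, l))"
      by (rule eigenrows_map_index[OF Y il])
    also have "\<dots> = comb (v i l)"
      using il by (simp add: comb_eq_iff Y_def block_index_lt)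
    also have "\<dots> = (M * E) $$ (i, l)"
      using v[OF il] mult_eigenrows_index[OF MK(1) il] by simp
    finally show "(E * ?Y) $$ (i, l) = (M * E) $$ (i, l)" .
  qed (use c MK in \<open>auto simp: eigenrows_def\<close>)
  \<comment> \<open>Multiplied by \<open>E\<close> from the left, \<open>Y * B\<close> and
    \<open>B * Y\<close> both become \<beta> times \<open>M * E\<close>, and \<open>E\<close> can be
    cancelled on base field matrices.\<close>
  have "E * map_mat to_ac (Y * B) = E * ?Y * ?B"
    unfolding to_ac.mat_hom_mult[OF Y B_carrier]
    by (rule assoc_mult_mat[OF eigenrows_carrier c, symmetric])
  also have "\<dots> = M * (E * ?B)"
    unfolding EY using MK c by (intro assoc_mult_mat) auto
  also have "\<dots> = \<beta> \<cdot>\<^sub>m (M * E)"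
    unfolding E_map_B by (rule mult_smult_distrib[OF MK(1) eigenrows_carrier])
  also have "\<dots> = E * ?B * ?Y"
    unfolding E_map_B EY[symmetric] by (rule mult_smult_assoc_mat[OF eigenrows_carrier c(1), symmetric])
  also have "\<dots> = E * map_mat to_ac (B * Y)"
    unfolding to_ac.mat_hom_mult[OF B_carrier Y]
    by (rule assoc_mult_mat[OF eigenrows_carrier c(2,1)])
  finally have comm: "Y * B = B * Y"
    using Y B_carrier by (intro eigenrows_map_inj) auto
  have "Y \<in> Units (ring_mat TYPE('a) (d * m) ())"
    unfolding units_ring_mat_iff_injective[OF Y]
  proof (intro ballI impI)
    fix x assume x: "x \<in> carrier_vec (d * m)" "Y *\<^sub>v x = 0\<^sub>v (d * m)"
    \<comment> \<open>This is \<open>E\<close> applied to \<open>x\<close>. Then \<open>M\<close>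
      applied to \<open>c\<close> equals \<open>E\<close> applied to \<open>Y *\<^sub>v x\<close>,
      which is zero; so \<open>c\<close> vanishes, and with it all coordinates
      \<open>x\<close>.\<close>
    define c where "c i = comb (\<lambda>j. x $ (d * i + j))" for i
    have "(\<Sum>i<m. c i * M $$ (r, i)) = 0" if r: "r < m" for r
    proof -
      have "(\<Sum>i<m. c i * M $$ (r, i)) =
          (\<Sum>i<m. \<Sum>j<d. (M * E) $$ (r, d * i + j) * to_ac (x $ (d * i + j)))"
        unfolding c_def comb_def sum_distrib_right
        by (intro sum.cong) (auto simp: mult_eigenrows_index[OF MK(1) r] block_index_lt)
      also have "\<dots> = (\<Sum>k<d * m. (E * ?Y) $$ (r, k) * to_ac (x $ k))"
        unfolding EY by (rule sum_blocks[symmetric])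
      also have "\<dots> = ((E * ?Y) *\<^sub>v map_vec to_ac x) $ r"
        using x c r by (simp add: scalar_prod_def atLeast0LessThan eigenrows_def)
      also have "(E * ?Y) *\<^sub>v map_vec to_ac x = E *\<^sub>v map_vec to_ac (Y *\<^sub>v x)"
        using x by (subst assoc_mult_mat_vec[OF eigenrows_carrier c(1)])
          (auto simp flip: to_ac.mult_mat_vec_hom[OF Y x(1)])
      also have "\<dots> $ r = 0"
        using r by (simp add: x scalar_prod_def eigenrows_def)
      finally show ?thesis .
    qed
    moreover have "\<forall>i<m. c i \<in> K" using comb_in_K by (simp add: c_def)
    ultimately have c0: "\<forall>i<m. c i = 0"
      using M unfolding K.inj_mats_def by blast
    show "x = 0\<^sub>v (d * m)"
    proof (rule eq_vecI)
      fix k assume k: "k < dim_vec (0\<^sub>v (d * m) :: 'a vec)"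
      then have "c (k div d) = comb (\<lambda>_. 0)" using c0 by (simp add: div_block_lt comb_def)
      then have "\<forall>j<d. x $ (d * (k div d) + j) = 0" by (simp add: c_def comb_eq_iff)
      then show "x $ k = 0\<^sub>v (d * m) $ k"
        using k d_pos by (metis mod_less_divisor mult_div_mod_eq index_zero_vec(1,2))
    qed (use x in auto)
  qed
  then have "Y \<in> C" using comm by (simp add: C_def)
  then show ?thesis using EY by blast
qed

lemma finite_C: "finite C"
proof -
  interpret U: finite_subfield "UNIV :: 'a set" by unfold_locales auto
  have "C \<subseteq> U.mats (d * m) (d * m)"
    by (auto simp: C_def Units_def ring_mat_simps U.mats_def)
  then show ?thesis using U.finite_mats finite_subset by blast
qed

text \<open>Different \<open>M\<close> have different lifts, because \<open>M\<close> can be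
  recovered from \<open>M * E\<close>.\<close>

lemma card_C_ge: "real (card C) \<ge> real CARD('a) ^ (d * m * m) / 4"
proof -
  obtain f where f: "\<And>M. M \<in> K.inj_mats m \<Longrightarrow> f M \<in> C"
    "\<And>M. M \<in> K.inj_mats m \<Longrightarrow> E * map_mat to_ac (f M) = M * E"
    using commuting_lift by metis
  have "inj_on f (K.inj_mats m)"
  proof (rule inj_onI)
    fix M N assume M: "M \<in> K.inj_mats m" and N: "N \<in> K.inj_mats m" and eq: "f M = f N"
    have c: "M \<in> carrier_mat m m" "N \<in> carrier_mat m m"
      using M N unfolding K.inj_mats_def K.mats_def by blast+
    show "M = N"
      using mult_eigenrows_inj[OF c] f(2)[OF M] f(2)[OF N] unfolding eq by metis
  qed
  then have "card (K.inj_mats m) \<le> card C"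
    using f(1) finite_C by (intro card_inj_on_le) auto
  moreover have "real (card K) ^ (m * m) = real CARD('a) ^ (d * m * m)"
    by (simp add: card_K power_mult mult.assoc)
  ultimately show ?thesis
    using K.card_inj_mats_ge[of m] by linarith
qed

end

text \<open>The counting of injective matrices, applied to the whole base field as its own
  subfield.\<close>

lemma card_units_ring_mat:
  shows "card (Units (ring_mat TYPE('a::{field, finite}) n ())) \<le> CARD('a) ^ (n * n)"
    and "real (card (Units (ring_mat TYPE('a) n ()))) \<ge> real CARD('a) ^ (n * n) / 4"
    and "finite (Units (ring_mat TYPE('a) n ()))"
proof -
  interpret U: finite_subfield "UNIV :: 'a set" by unfold_locales auto
  have sub: "Units (ring_mat TYPE('a) n ()) \<subseteq> U.mats n n"
    by (auto simp: Units_def ring_mat_simps U.mats_def)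
  then show fin: "finite (Units (ring_mat TYPE('a) n ()))" using U.finite_mats finite_subset by blast
  show "card (Units (ring_mat TYPE('a) n ())) \<le> CARD('a) ^ (n * n)"
    using card_mono[OF U.finite_mats sub] by (simp add: U.card_mats)
  have "U.inj_mats n \<subseteq> Units (ring_mat TYPE('a) n ())"
  proof
    fix M assume M: "M \<in> U.inj_mats n"
    then have c: "M \<in> carrier_mat n n" by (auto simp: U.inj_mats_def U.mats_def)
    show "M \<in> Units (ring_mat TYPE('a) n ())"
      unfolding units_ring_mat_iff_injective[OF c]
    proof (intro ballI impI)
      fix v assume v: "v \<in> carrier_vec n" "M *\<^sub>v v = 0\<^sub>v n"
      have "(\<Sum>i<n. v $ i * M $$ (r, i)) = 0" if "r < n" for r
        using arg_cong[OF v(2), of "\<lambda>x. vec_index x r"] that v(1) c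
        by (simp add: scalar_prod_def atLeast0LessThan mult.commute)
      then have "\<forall>i<n. v $ i = 0" using M by (auto simp: U.inj_mats_def)
      then show "v = 0\<^sub>v n" using v(1) by (intro eq_vecI) auto
    qed
  qed
  then show "real (card (Units (ring_mat TYPE('a) n ()))) \<ge> real CARD('a) ^ (n * n) / 4"
    using U.card_inj_mats_ge[of n] card_mono[OF fin] by (smt (verit) of_nat_le_iff)
qed

section \<open>Elements of small support\<close>

text \<open>Elimination: an equation with a nonzero coefficient at \<open>i0\<close> expresses that
  unknown through the others, leaving one equation and one unknown fewer. Below, this takes the
  place of dimension formulas for intersections of eigenspaces.\<close>

lemma underdetermined_system:
  fixes f :: "'s \<Rightarrow> 'i \<Rightarrow> 'a::field"
  assumes "finite S" "finite I" "card S < card I"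
  shows "\<exists>c. (\<exists>i\<in>I. c i \<noteq> 0) \<and> (\<forall>s\<in>S. (\<Sum>i\<in>I. c i * f s i) = 0)"
  using assms
proof (induction S arbitrary: I f rule: finite_induct)
  case empty
  then obtain i where "i \<in> I" by fastforce
  then show ?case by (intro exI[of _ "\<lambda>_. 1"]) auto
next
  case (insert s0 S)
  show ?case
  proof (cases "\<forall>i\<in>I. f s0 i = 0")
    case True
    from insert.IH[of I f] insert.prems insert.hyps
    show ?thesis using True by auto
  next
    case False
    then obtain i0 where i0: "i0 \<in> I" "f s0 i0 \<noteq> 0" by auto
    define J where "J = I - {i0}"
    \<comment> \<open>The coefficients of equation \<open>s\<close> after substituting for the
      unknown \<open>i0\<close>; the value \<open>t\<close> below is the one that solves equation
      \<open>s0\<close>.\<close>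
    define g where "g s i = f s i - f s i0 * f s0 i / f s0 i0" for s i
    have J: "finite J" "card S < card J" "i0 \<notin> J" "I = insert i0 J"
      using insert.prems insert.hyps i0 by (auto simp: J_def)
    from insert.IH[OF J(1,2), of g] obtain c where
      c: "\<exists>i\<in>J. c i \<noteq> 0" "\<And>s. s \<in> S \<Longrightarrow> (\<Sum>i\<in>J. c i * g s i) = 0" by auto
    define t where "t = - (\<Sum>i\<in>J. c i * f s0 i) / f s0 i0"
    define c' where "c' = c(i0 := t)"
    have eq: "(\<Sum>i\<in>I. c' i * f s i) = t * f s i0 + (\<Sum>i\<in>J. c i * f s i)" for s
    proof -
      have "(\<Sum>i\<in>J. c' i * f s i) = (\<Sum>i\<in>J. c i * f s i)"
        using J(3) by (intro sum.cong) (auto simp: c'_def)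
      then show ?thesis using J by (simp add: c'_def)
    qed
    have "(\<Sum>i\<in>I. c' i * f s i) = 0" if "s \<in> S" for s
    proof -
      have "0 = (\<Sum>i\<in>J. c i * f s i - (c i * f s0 i) * (f s i0 / f s0 i0))"
        using c(2)[OF that] by (simp add: g_def algebra_simps)
      also have "\<dots> = (\<Sum>i\<in>J. c i * f s i) + t * f s i0"
        by (simp add: sum_subtractf sum_distrib_right sum_divide_distrib t_def)
      finally show ?thesis unfolding eq by (simp add: add.commute)
    qed
    moreover have "(\<Sum>i\<in>I. c' i * f s0 i) = 0"
      unfolding eq using i0 by (simp add: t_def)
    moreover have "\<exists>i\<in>I. c' i \<noteq> 0"
      using c(1) J by (auto simp: c'_def)
    ultimately show ?thesis by (intro exI[of _ c']) auto
  qed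
qed

text \<open>A rank factorization: all columns are expressed through a maximal independent set
  \<open>S\<close> of columns. A row annihilates the matrix as soon as it annihilates
  \<open>S\<close>, which is a system of only \<open>card S\<close> equations.\<close>

lemma rank_decomposition:
  fixes A :: "'a::field mat"
  assumes A: "A \<in> carrier_mat n nc"
  obtains S a where "finite S" "card S = vec_space.rank n A"
    "\<And>i j. i < n \<Longrightarrow> j < nc \<Longrightarrow> A $$ (i, j) = (\<Sum>v\<in>S. vec_index v i * a j v)"
proof -
  interpret vec_space "TYPE('a)" n .
  let ?P = "\<lambda>T. T \<subseteq> set (cols A) \<and> lin_indpt T"
  have cA: "set (cols A) \<subseteq> carrier_vec n" using A cols_dim by blast
  have "lin_indpt {}" by (simp add: lin_dep_def)
  then obtain S where S: "finite S" "maximal S ?P"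
    using maximal_exists_superset[of "set (cols A)" ?P "{}"] by auto
  have SA: "S \<subseteq> set (cols A)" "lin_indpt S" using S(2) by (auto simp: maximal_def)
  then have SC: "S \<subseteq> carrier_vec n" using cA by blast
  have card: "card S = rank A" using rank_card_indpt[OF A S(2)] by simp
  have "\<exists>a. \<forall>i<n. A $$ (i, j) = (\<Sum>v\<in>S. vec_index v i * a v)" if j: "j < nc" for j
  proof -
    have c: "col A j \<in> set (cols A)" "col A j \<in> carrier_vec n" using A j by (auto simp: cols_def)
    have "col A j \<in> span S"
    proof (rule ccontr)
      assume ns: "col A j \<notin> span S"
      then have "col A j \<notin> S" using in_own_span[OF SC] by blast
      moreover have "lin_indpt (S \<union> {col A j})"
        using ns c SC SA(2) S(1) lin_dep_iff_in_span calculation by (metis (no_types, lifting))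
      ultimately show False
        using S(2) SA(1) c(1) unfolding maximal_def by blast
    qed
    then have "\<exists>a. lincomb a S = col A j"
      using finite_in_span[OF S(1), of "col A j"] SC by simp
    then obtain a where a: "lincomb a S = col A j" by blast
    have "A $$ (i, j) = (\<Sum>v\<in>S. vec_index v i * a v)" if i: "i < n" for i
    proof -
      have "A $$ (i, j) = col A j $ i" using A i j by simp
      also have "\<dots> = (\<Sum>v\<in>S. a v * vec_index v i)"
        unfolding a[symmetric] by (rule lincomb_index[OF i SC])
      finally show ?thesis by (simp add: mult.commute)
    qed
    then show ?thesis by blast
  qed
  then obtain a where "\<And>i j. i < n \<Longrightarrow> j < nc \<Longrightarrow> A $$ (i, j) = (\<Sum>v\<in>S. vec_index v i * a j v)"
    by metis
  then show thesis using that[OF S(1) card] by blast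
qed

lemma left_kernel_of_decomposition:
  fixes A :: "nat \<Rightarrow> 'a::comm_semiring_0"
  assumes "\<And>k. k < n \<Longrightarrow> A k = (\<Sum>v\<in>S. g v k * a v)"
    and "\<And>v. v \<in> S \<Longrightarrow> (\<Sum>k<n. c k * g v k) = 0"
  shows "(\<Sum>k<n. c k * A k) = 0"
proof -
  have "(\<Sum>k<n. c k * A k) = (\<Sum>k<n. \<Sum>v\<in>S. c k * g v k * a v)"
    using assms(1) by (simp add: sum_distrib_left mult.assoc)
  also have "\<dots> = (\<Sum>v\<in>S. (\<Sum>k<n. c k * g v k) * a v)"
    unfolding sum_distrib_right by (rule sum.swap)
  finally show ?thesis using assms(2) by simp
qed

section \<open>The Frobenius map and large eigenspaces in characteristic 2\<close>

lemma two_eq_0_bit_ac: "(2 :: bit alg_closure) = 0"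
proof -
  have "to_ac (2 :: bit) = (2 :: bit alg_closure)" by (rule to_ac_numeral)
  then show ?thesis by simp
qed

lemma sum_square_bit_ac:
  fixes f :: "'i \<Rightarrow> bit alg_closure"
  shows "(sum f I)\<^sup>2 = (\<Sum>i\<in>I. (f i)\<^sup>2)"
  by (induction I rule: infinite_finite_induct) (simp_all add: power2_sum two_eq_0_bit_ac)

lemma to_ac_bit_square: "(to_ac (b :: bit))\<^sup>2 = to_ac b"
  by (cases b) auto

text \<open>If \<open>\<mu> \<noteq> \<mu>\<^sup>2\<close>, then the Frobenius conjugate of the \<open>\<mu>\<close>-eigenspace is the
  \<open>\<mu>\<^sup>2\<close>-eigenspace; two eigenspaces of codimension below \<open>n/2\<close> cannot be independent.\<close>

lemma large_eigenspace_imp_eigenvalue_1: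
  fixes x :: "bit mat"
  assumes x: "x \<in> carrier_mat n n" and "\<mu> \<noteq> 0"
    and S: "finite S" "2 * card S < n"
    and dec: "\<And>k l. k < n \<Longrightarrow> l < n \<Longrightarrow>
      to_ac (x $$ (k, l)) - (if k = l then \<mu> else 0) = (\<Sum>v\<in>S. g v k * a l v)"
  shows "\<mu> = 1"
proof -
  \<comment> \<open>The disjoint sum indexes \<open>2 * card S\<close> equations in \<open>n\<close>
    unknowns: \<open>c\<close> is to annihilate every \<open>g v\<close> as well as its entrywise
    square.\<close>
  define f where "f s k = (case s of Inl v \<Rightarrow> g v k | Inr v \<Rightarrow> (g v k)\<^sup>2)" for s k
  have "card (S <+> S) < card {..<n}" using S by (simp add: card_Plus)
  with underdetermined_system[of "S <+> S" "{..<n}" f] S(1) obtain c where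
    c: "\<exists>k<n. c k \<noteq> 0" "\<And>s. s \<in> S <+> S \<Longrightarrow> (\<Sum>k<n. c k * f s k) = 0" by auto
  have c1: "(\<Sum>k<n. c k * g v k) = 0" and c2: "(\<Sum>k<n. c k * (g v k)\<^sup>2) = 0" if "v \<in> S" for v
    using c(2)[of "Inl v"] c(2)[of "Inr v"] that by (auto simp: f_def)
  have delta: "(\<Sum>k<n. c k * (if k = l then t else 0)) = c l * t" if "l < n" for l t
  proof -
    have "(\<Sum>k<n. c k * (if k = l then t else 0)) = (\<Sum>k<n. if k = l then c k * t else 0)"
      by (intro sum.cong) auto
    then show ?thesis using that by simp
  qed
  have e1: "(\<Sum>k<n. c k * to_ac (x $$ (k, l))) = c l * \<mu>" if l: "l < n" for l
    using left_kernel_of_decomposition[OF dec[OF _ l] c1] delta[OF l]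
    by (simp add: right_diff_distrib sum_subtractf)
  have sq: "to_ac (x $$ (k, l)) - (if k = l then \<mu>\<^sup>2 else 0) = (\<Sum>v\<in>S. (g v k)\<^sup>2 * (a l v)\<^sup>2)"
    if "k < n" "l < n" for k l
  proof -
    have "(to_ac (x $$ (k, l)) - (if k = l then \<mu> else 0))\<^sup>2 =
        to_ac (x $$ (k, l)) - (if k = l then \<mu>\<^sup>2 else 0)"
    proof -
      have neg: "y = - y" for y :: "bit alg_closure"
        using two_eq_0_bit_ac by (metis add_eq_0_iff mult_2 mult_zero_left)
      have "(s - t)\<^sup>2 = s\<^sup>2 - t\<^sup>2" for s t :: "bit alg_closure"
        using neg[of "t\<^sup>2"] by (simp add: power2_diff two_eq_0_bit_ac)
      then show ?thesis by (simp add: to_ac_bit_square)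
    qed
    then show ?thesis
      unfolding dec[OF that] sum_square_bit_ac by (simp add: power_mult_distrib)
  qed
  have e2: "(\<Sum>k<n. c k * to_ac (x $$ (k, l))) = c l * \<mu>\<^sup>2" if l: "l < n" for l
    using left_kernel_of_decomposition[OF sq[OF _ l] c2] delta[OF l]
    by (simp add: right_diff_distrib sum_subtractf)
  \<comment> \<open>The row \<open>c\<close> is an eigenrow for both values, so they agree at a
    nonzero coordinate; cancelling \<mu> gives 1.\<close>
  from c(1) obtain l where "l < n" "c l \<noteq> 0" by blast
  then show ?thesis using e1[of l] e2[of l] \<open>\<mu> \<noteq> 0\<close> by (simp add: power2_eq_square)
qed

lemma mat_supp_attained:
  fixes x :: "'a::field mat"
  obtains \<mu> :: "'a alg_closure" where "\<mu> \<noteq> 0"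
    "mat_supp x = vec_space.rank (dim_row x) (map_mat to_ac x - \<mu> \<cdot>\<^sub>m 1\<^sub>m (dim_row x))"
proof -
  let ?F = "(\<lambda>c. vec_space.rank (dim_row x) (map_mat to_ac x - c \<cdot>\<^sub>m 1\<^sub>m (dim_row x)))
    ` {c :: 'a alg_closure. c \<noteq> 0}"
  have "?F \<noteq> {}" by (auto intro: exI[of _ 1])
  then have "mat_supp x \<in> ?F" unfolding mat_supp_def by (rule Inf_nat_def1)
  then show thesis using that by auto
qed

text \<open>The eigenspace of \<open>x\<close> for \<open>1\<close> meets the \<open>m\<close>-dimensional \<open>\<beta>\<close>-eigenspace of the first factor
  in some \<open>U \<noteq> 0\<close>, which is then a \<open>1/\<beta>\<close>-eigenvector of the second factor. All eigenvectors
  are row vectors.\<close>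

lemma inverse_root_of_small_support:
  fixes p :: "bit poly"
  assumes monic: "lead_coeff p = 1" and deg: "degree p = d" and d3: "d \<ge> 3"
    and root: "poly (map_poly to_ac p) \<beta> = 0"
    and n: "n = d * m" and m: "m \<ge> 1"
    and B_def: "B = diag_block_mat (replicate m (companion_mat p))"
    and h: "h \<in> carrier_mat n n" "hi \<in> carrier_mat n n" "hi * h = 1\<^sub>m n"
    and g: "g \<in> carrier_mat n n" "gi \<in> carrier_mat n n" "g * gi = 1\<^sub>m n" "gi * g = 1\<^sub>m n"
    and x: "x = (h * B * hi) * (g * B * gi)" and supp: "mat_supp x < m"
  shows "poly (map_poly to_ac p) (inverse \<beta>) = 0"
proof -
  let ?q = "map_poly to_ac p"
  have q: "lead_coeff ?q = 1" "degree ?q = d"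
  proof -
    show "degree ?q = d" using deg by (subst degree_map_poly) auto
    then show "lead_coeff ?q = 1" using monic deg by (simp add: coeff_map_poly)
  qed
  have d: "d > 0" using d3 by simp
  have B: "B \<in> carrier_mat n n"
    unfolding B_def n by (rule block_companion_carrier[OF monic deg d])
  have xc: "x \<in> carrier_mat n n" using B h g by (auto simp: x)
  obtain \<mu> where mu_supp: "\<mu> \<noteq> 0"
    "mat_supp x = vec_space.rank (dim_row x) (map_mat to_ac x - \<mu> \<cdot>\<^sub>m 1\<^sub>m (dim_row x))"
    by (rule mat_supp_attained)
  have "dim_row x = n" using xc by simp
  note mu = mu_supp(1) supp[unfolded mu_supp(2) this]
  let ?A = "map_mat to_ac x - \<mu> \<cdot>\<^sub>m 1\<^sub>m n"
  have "?A \<in> carrier_mat n n" using xc by auto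
  then obtain S a where S: "finite S" "card S = vec_space.rank n ?A"
    and dec: "\<And>k l. k < n \<Longrightarrow> l < n \<Longrightarrow> ?A $$ (k, l) = (\<Sum>v\<in>S. vec_index v k * a l v)"
    by (rule rank_decomposition) blast
  have dec': "to_ac (x $$ (k, l)) - (if k = l then \<mu> else 0) = (\<Sum>v\<in>S. vec_index v k * a l v)"
    if "k < n" "l < n" for k l
    using dec[OF that] that xc by auto
  have "2 * card S < n"
  proof -
    have "2 * card S < 2 * m" using S mu by simp
    also have "\<dots> \<le> n" unfolding n using d3 by (intro mult_right_mono) auto
    finally show ?thesis .
  qed
  then have mu1: "\<mu> = 1"
    using large_eigenspace_imp_eigenvalue_1[OF xc mu(1) S(1) _ dec'] by blast
  define E where "E = eigenrows d m \<beta>"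
  define H where "H = map_mat to_ac h"
  define H' where "H' = map_mat to_ac hi"
  define G where "G = map_mat to_ac g"
  define G' where "G' = map_mat to_ac gi"
  define B' where "B' = map_mat to_ac B"
  define X' where "X' = map_mat to_ac x"
  have E: "E \<in> carrier_mat m n" by (simp add: E_def n)
  have carr: "H \<in> carrier_mat n n" "H' \<in> carrier_mat n n" "G \<in> carrier_mat n n"
    "G' \<in> carrier_mat n n" "B' \<in> carrier_mat n n" "X' \<in> carrier_mat n n"
    using h g B xc by (simp_all add: H_def H'_def G_def G'_def B'_def X'_def)
  have inv: "H' * H = 1\<^sub>m n" "G * G' = 1\<^sub>m n" "G' * G = 1\<^sub>m n"
    using h g to_ac.mat_hom_one[where 'a = bit]
    by (simp_all add: H_def H'_def G_def G'_def flip: to_ac.mat_hom_mult)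
  have X': "X' = (H * B' * H') * (G * B' * G')"
    using h g B by (simp add: X'_def x H_def H'_def G_def G'_def B'_def to_ac.mat_hom_mult[of _ n n _ n])
  have EB: "E * B' = \<beta> \<cdot>\<^sub>m E"
    unfolding E_def B'_def B_def map_block_companion
    by (rule eigenrows_mult_block_companion[OF q d root])
  have EH: "E * H' \<in> carrier_mat m n" using E carr by auto
  \<comment> \<open>The rows of \<open>E * H'\<close> are \<beta>-eigenrows of the first factor.
    Fewer than \<open>m\<close> conditions on \<open>m\<close> coefficients leave a nonzero
    combination that annihilates \<open>S\<close>.\<close>
  obtain c where c: "\<exists>i<m. c i \<noteq> 0"
    "\<And>v. v \<in> S \<Longrightarrow> (\<Sum>i<m. c i * (\<Sum>k<n. (E * H') $$ (i, k) * vec_index v k)) = 0"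
    using underdetermined_system[of S "{..<m}" "\<lambda>v i. \<Sum>k<n. (E * H') $$ (i, k) * vec_index v k"]
      S mu(2) by auto
  define R where "R = mat 1 m (\<lambda>(_, i). c i)"
  have R: "R \<in> carrier_mat 1 m" by (simp add: R_def)
  \<comment> \<open>One vector in three coordinate systems: \<open>W\<close> is an eigenrow of
    \<open>B'\<close>, \<open>U\<close> is the matching eigenrow of the first factor, and
    \<open>Z\<close> is \<open>U\<close> in the coordinates where the second factor becomes
    \<open>B'\<close>.\<close>
  define W where "W = R * E"
  define U where "U = W * H'"
  define Z where "Z = U * G"
  have W: "W \<in> carrier_mat 1 n" using R E by (auto simp: W_def)
  have U: "U \<in> carrier_mat 1 n" using W carr by (auto simp: U_def)
  have Z: "Z \<in> carrier_mat 1 n" using U carr by (auto simp: Z_def)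
  note assoc = assoc_mult_mat[of _ 1 n _ n _ n]
  have W0: "W \<noteq> 0\<^sub>m 1 n"
  proof
    assume eq: "W = 0\<^sub>m 1 n"
    have "c i = 0" if "i < m" for i
    proof -
      \<comment> \<open>Column \<open>d * i\<close> of \<open>W\<close> is exactly
        \<open>c i\<close>.\<close>
      have "d * i < d * m" using that d by simp
      from mult_eigenrows_index[OF R _ this, of 0 \<beta>] show ?thesis
        using eq that d by (simp add: W_def E_def R_def n)
    qed
    then show False using c(1) by blast
  qed
  have UR: "U = R * (E * H')"
    unfolding U_def W_def by (rule assoc_mult_mat[OF R E carr(2)])
  have US: "(\<Sum>k<n. U $$ (0, k) * vec_index v k) = 0" if "v \<in> S" for v
  proof -
    have "U $$ (0, k) = (\<Sum>i<m. c i * (E * H') $$ (i, k))" if "k < n" for k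
      unfolding UR using mat_mult_index_lessThan[OF R EH _ that, of 0] by (simp add: R_def)
    then have "(\<Sum>k<n. U $$ (0, k) * vec_index v k) =
        (\<Sum>k<n. \<Sum>i<m. c i * ((E * H') $$ (i, k) * vec_index v k))"
      by (simp add: sum_distrib_right mult.assoc)
    also have "\<dots> = (\<Sum>i<m. c i * (\<Sum>k<n. (E * H') $$ (i, k) * vec_index v k))"
      unfolding sum_distrib_left by (rule sum.swap)
    finally show ?thesis using c(2)[OF that] by simp
  qed
  have UX: "U * X' = U"
  proof (rule eq_matI)
    fix i l assume "i < dim_row U" "l < dim_col U"
    then have il: "i = 0" "l < n" using U by auto
    have "0 = (\<Sum>k<n. U $$ (0, k) * (to_ac (x $$ (k, l)) - (if k = l then \<mu> else 0)))"
      by (rule left_kernel_of_decomposition[OF dec'[OF _ il(2)] US, symmetric])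
    also have "\<dots> = (\<Sum>k<n. U $$ (0, k) * X' $$ (k, l)) - (\<Sum>k<n. if k = l then U $$ (0, k) else 0)"
      unfolding sum_subtractf[symmetric] using il xc
      by (intro sum.cong) (auto simp: X'_def mu1 right_diff_distrib)
    finally show "(U * X') $$ (i, l) = U $$ (i, l)"
      using mat_mult_index_lessThan[OF U carr(6) _ il(2), of 0] il by simp
  qed (use U carr in auto)
  have WB: "W * B' = \<beta> \<cdot>\<^sub>m W"
    unfolding W_def assoc_mult_mat[OF R E carr(5)] EB by (rule mult_smult_distrib[OF R E])
  have UH: "U * H = W"
    unfolding U_def using W carr inv by (simp add: assoc)
  \<comment> \<open>The first factor scales \<open>U\<close> by \<beta>, and the product fixes
    \<open>U\<close>; hence \<open>U\<close> is \<beta> times its image under the second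
    factor.\<close>
  have "U * X' = ((U * H) * B' * H') * (G * B' * G')"
    unfolding X' using U carr by (simp add: assoc)
  also have "\<dots> = \<beta> \<cdot>\<^sub>m U * (G * B' * G')"
    by (simp only: UH WB mult_smult_assoc_mat[OF W carr(2)] flip: U_def)
  also have "\<dots> = \<beta> \<cdot>\<^sub>m (Z * B' * G')"
    using U carr mult_smult_assoc_mat[OF U, of "G * B' * G'" n \<beta>] by (simp add: Z_def assoc)
  finally have "U = \<beta> \<cdot>\<^sub>m (Z * B' * G')" using UX by simp
  then have "Z = \<beta> \<cdot>\<^sub>m (Z * B' * G') * G" by (simp add: Z_def)
  also have "\<dots> = \<beta> \<cdot>\<^sub>m (Z * B')"
    using Z carr inv mult_smult_assoc_mat[of "Z * B' * G'" 1 n G n \<beta>] by (simp add: assoc)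
  finally have ZB: "Z = \<beta> \<cdot>\<^sub>m (Z * B')" .
  have "W = Z * G' * H"
    using U carr inv by (simp add: Z_def assoc flip: UH)
  then have Z0: "Z \<noteq> 0\<^sub>m 1 n" using W0 carr by auto
  \<comment> \<open>If \<beta> were 0, the relation \<open>ZB\<close> would make \<open>Z\<close>
    zero.\<close>
  have "0 \<cdot>\<^sub>m (Z * B') = 0\<^sub>m 1 n" using Z carr by (intro eq_matI) auto
  then have "\<beta> \<noteq> 0" using ZB Z0 by metis
  then have "inverse \<beta> \<cdot>\<^sub>m Z = Z * B'"
    by (subst ZB) (auto intro!: eq_matI)
  then have "Z * diag_block_mat (replicate m (companion_mat ?q)) = inverse \<beta> \<cdot>\<^sub>m Z"
    by (simp add: B'_def B_def map_block_companion)
  then show ?thesis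
    using block_companion_eigenmat(2)[OF q d _ _ Z0[unfolded n]] Z n by blast
qed

section \<open>Conjugacy classes\<close>

instance bit :: finite
proof
  have "(UNIV :: bit set) = {0, 1}" by (auto intro: bit.exhaust)
  then show "finite (UNIV :: bit set)" by (metis finite.simps)
qed

lemma card_bit: "CARD(bit) = 2"
proof -
  have "(UNIV :: bit set) = {0, 1}" by (auto intro: bit.exhaust)
  then have "CARD(bit) = card {0 :: bit, 1}" by (rule arg_cong)
  then show ?thesis by simp
qed

lemma conj_class_units_of:
  assumes "monoid R"
  shows "conj_class (units_of R) s = (\<lambda>h. h \<otimes>\<^bsub>R\<^esub> s \<otimes>\<^bsub>R\<^esub> inv\<^bsub>R\<^esub> h) ` Units R"
  unfolding conj_class_def units_of_carrier units_of_mult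
  using monoid.units_of_inv[OF assms] by (auto simp: image_iff) metis+

text \<open>Orbit-stabilizer for the unit group acting on the monoid by conjugation: the fibres of
  the conjugation map are the left cosets of the centralizer.\<close>

lemma card_Units_eq_conj_class_times_centralizer:
  assumes R: "monoid R" and fin: "finite (Units R)" and s: "s \<in> carrier R"
  shows "card (Units R) =
    card (conj_class (units_of R) s) * card {h \<in> Units R. h \<otimes>\<^bsub>R\<^esub> s = s \<otimes>\<^bsub>R\<^esub> h}"
proof -
  interpret monoid R by (fact R)
  define C where "C = {h \<in> Units R. h \<otimes>\<^bsub>R\<^esub> s = s \<otimes>\<^bsub>R\<^esub> h}"
  define f where "f h = h \<otimes>\<^bsub>R\<^esub> s \<otimes>\<^bsub>R\<^esub> inv\<^bsub>R\<^esub> h" for h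
  have comm_iff: "f h = s \<longleftrightarrow> h \<otimes>\<^bsub>R\<^esub> s = s \<otimes>\<^bsub>R\<^esub> h" if h: "h \<in> Units R" for h
  proof
    assume "f h = s"
    then have "s \<otimes>\<^bsub>R\<^esub> h = f h \<otimes>\<^bsub>R\<^esub> h" by simp
    also have "\<dots> = h \<otimes>\<^bsub>R\<^esub> s" using h s by (simp add: f_def m_assoc Units_closed)
    finally show "h \<otimes>\<^bsub>R\<^esub> s = s \<otimes>\<^bsub>R\<^esub> h" by simp
  next
    assume "h \<otimes>\<^bsub>R\<^esub> s = s \<otimes>\<^bsub>R\<^esub> h"
    then show "f h = s" using h s by (simp add: f_def m_assoc Units_closed)
  qed
  have f_mult: "f (g \<otimes>\<^bsub>R\<^esub> h) = g \<otimes>\<^bsub>R\<^esub> f h \<otimes>\<^bsub>R\<^esub> inv\<^bsub>R\<^esub> g"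
    if "g \<in> Units R" "h \<in> Units R" for g h
  proof -
    have "inv\<^bsub>R\<^esub> (g \<otimes>\<^bsub>R\<^esub> h) = inv\<^bsub>R\<^esub> h \<otimes>\<^bsub>R\<^esub> inv\<^bsub>R\<^esub> g"
      using group.inv_mult_group[OF units_group, of g h] that
      by (simp add: units_of_carrier units_of_mult units_of_inv)
    then show ?thesis using that s by (simp add: f_def m_assoc Units_closed)
  qed
  have fiber: "card {h \<in> Units R. f h = f g} = card C" if g: "g \<in> Units R" for g
  proof -
    have "{h \<in> Units R. f h = f g} = (\<lambda>c. g \<otimes>\<^bsub>R\<^esub> c) ` C"
    proof (intro equalityI subsetI)
      fix h assume "h \<in> {h \<in> Units R. f h = f g}"
      then have h: "h \<in> Units R" "f h = f g" by auto
      let ?c = "inv\<^bsub>R\<^esub> g \<otimes>\<^bsub>R\<^esub> h"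
      have c: "?c \<in> Units R" using g h by simp
      have "f ?c = inv\<^bsub>R\<^esub> g \<otimes>\<^bsub>R\<^esub> f g \<otimes>\<^bsub>R\<^esub> g"
        using f_mult[of "inv\<^bsub>R\<^esub> g" h] g h by simp
      also have "\<dots> = s"
        using g s by (simp add: f_def m_assoc Units_closed) (simp add: m_assoc[symmetric] Units_closed)
      finally have "?c \<in> C" using c comm_iff by (simp add: C_def)
      moreover have "h = g \<otimes>\<^bsub>R\<^esub> ?c" using g h by (simp add: m_assoc[symmetric] Units_closed)
      ultimately show "h \<in> (\<lambda>c. g \<otimes>\<^bsub>R\<^esub> c) ` C" by (simp add: image_iff) metis
    next
      fix h assume "h \<in> (\<lambda>c. g \<otimes>\<^bsub>R\<^esub> c) ` C"
      then obtain c where c: "c \<in> Units R" "f c = s" "h = g \<otimes>\<^bsub>R\<^esub> c"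
        using comm_iff by (auto simp: C_def)
      then show "h \<in> {h \<in> Units R. f h = f g}"
        using g f_mult[of g c] by (simp add: f_def)
    qed
    moreover have "inj_on (\<lambda>c. g \<otimes>\<^bsub>R\<^esub> c) C"
      using g by (auto simp: inj_on_def C_def Units_closed)
    ultimately show ?thesis by (simp add: card_image)
  qed
  have "card (Units R) = (\<Sum>t\<in>f ` Units R. card {h \<in> Units R. f h = t})"
    using sum.image_gen[OF fin, of "\<lambda>_. 1 :: nat" f] by simp
  also have "\<dots> = (\<Sum>t\<in>f ` Units R. card C)"
    using fiber by (intro sum.cong) auto
  finally show ?thesis
    unfolding conj_class_units_of[OF R] by (simp add: f_def C_def)
qed

text \<open>The logarithm of the class size is that of the group order minus that of the centralizer
  order. Both are known up to \<open>2 * ln 2\<close>, with main terms in ratio \<open>d\<close>;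
  dividing by \<open>ln (real nG)\<close>, which is of order \<open>n * n\<close>, gives the
  error.\<close>

lemma log_ratio_bound:
  fixes nG nC nS d n :: nat
  assumes "nG = nS * nC" and dn: "d * e = n * n" and d: "d \<ge> 1" and n: "n \<ge> 2"
    and G: "nG \<le> 2 ^ (n * n)" "2 ^ (n * n) / 4 \<le> real nG"
    and C: "nC \<le> 2 ^ e" "2 ^ e / 4 \<le> real nC"
  shows "\<bar>ln (real nS) / ln (real nG) - (1 - 1 / real d)\<bar> \<le> 4 * real n powi (-2)"
proof -
  let ?L = "ln (2 :: real)"
  have L: "?L > 0" by simp
  have range: "real k * ?L - 2 * ?L \<le> ln (real N)" "ln (real N) \<le> real k * ?L" "N > 0"
    if "N \<le> 2 ^ k" "2 ^ k / 4 \<le> real N" for N k :: nat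
  proof -
    have pos: "(0::real) < 2 ^ k / 4" by simp
    then have N: "real N > 0" using that(2) by linarith
    then show "N > 0" by simp
    have "ln ((2::real) ^ k / 4) \<le> ln (real N)" using that(2) pos N by simp
    moreover have "ln ((2::real) ^ k / 4) = real k * ?L - 2 * ?L"
      using ln_realpow[of 2 2] by (simp add: ln_div ln_realpow)
    ultimately show "real k * ?L - 2 * ?L \<le> ln (real N)" by simp
    have "real N \<le> 2 ^ k" using that(1) by (metis of_nat_le_iff of_nat_numeral of_nat_power)
    then have "ln (real N) \<le> ln (2 ^ k)" using N by simp
    then show "ln (real N) \<le> real k * ?L" by (simp add: ln_realpow)
  qed
  note rG = range[OF G] and rC = range[OF C]
  have S: "nS > 0" using rG(3) assms(1) by (auto intro: Nat.gr0I)
  define a where "a = ln (real nG)"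
  define c where "c = ln (real nC)"
  have lnS: "ln (real nS) = a - c"
    using S rC(3) by (simp add: a_def c_def assms(1) ln_mult)
  \<comment> \<open>This makes the loss \<open>2 * ?L\<close> at most half of the main term, whence
    the factor 1/2 in \<open>a_lb\<close>.\<close>
  have n4: "(4::real) \<le> real (n * n)"
    using mult_mono[OF n n] by (simp flip: of_nat_mult)
  have "4 * ?L \<le> real (n * n) * ?L" using n4 L by (intro mult_right_mono) auto
  then have a_lb: "a \<ge> real (n * n) * ?L / 2" using rG(1) unfolding a_def by linarith
  have npos: "real (n * n) * ?L / 2 > 0" using n4 L by simp
  have a_pos: "a > 0" using a_lb npos by linarith
  have de: "real (n * n) = real d * real e" by (simp flip: dn)
  have "a / real d \<le> real e * ?L"
    using rG(2) d unfolding a_def de by (simp add: divide_le_eq mult_ac)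
  moreover have "a / real d \<ge> real e * ?L - 2 * ?L"
  proof -
    have "2 * ?L \<le> real d * (2 * ?L)" using d L by simp
    then have "real d * real e * ?L - real d * (2 * ?L) \<le> a"
      using rG(1) unfolding a_def de by linarith
    then have "real d * (real e * ?L - 2 * ?L) \<le> a"
      by (simp only: right_diff_distrib mult.assoc)
    then show ?thesis using d by (simp add: le_divide_eq mult_ac)
  qed
  \<comment> \<open>Both numbers lie in the interval of length \<open>2 * ?L\<close> ending at
    \<open>real e * ?L\<close>. Division by the lower bound for \<open>a\<close> produces the
    constant 4.\<close>
  ultimately have "\<bar>a / real d - c\<bar> \<le> 2 * ?L"
    using rC(1,2) unfolding c_def by linarith
  then have "\<bar>a / real d - c\<bar> / a \<le> 2 * ?L / (real (n * n) * ?L / 2)"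
    using a_lb npos by (intro frac_le) auto
  also have "\<dots> = 4 * real n powi (-2)"
    using n L by (simp add: power_int_minus power2_eq_square field_simps)
  finally have "\<bar>a / real d - c\<bar> / a \<le> 4 * real n powi (-2)" .
  moreover have "ln (real nS) / ln (real nG) - (1 - 1 / real d) = (a / real d - c) / a"
    unfolding lnS using a_pos d by (simp add: a_def[symmetric] field_simps)
  ultimately show ?thesis using a_pos by simp
qed

theorem theorem1p2:
  shows "\<exists>K::real. K > 0 \<and>
    (\<forall>(p :: bit poly) (d::nat) (m::nat) (n::nat) (S :: bit mat set).
       lead_coeff p = 1 \<longrightarrow> irreducible p \<longrightarrow> degree p = d \<longrightarrow> d \<ge> 3 \<longrightarrow>
       \<not> (\<forall>a \<in> ac_roots p. inverse a \<in> ac_roots p) \<longrightarrow>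
       m \<ge> 1 \<longrightarrow> n = d * m \<longrightarrow>
       S = conj_class (GL TYPE(bit) n) (diag_block_mat (replicate m (companion_mat p))) \<longrightarrow>
       \<bar>ln (real (card S)) / ln (real (card (carrier (GL TYPE(bit) n)))) - (1 - 1 / real d)\<bar>
           \<le> K * real n powi (-2) \<and>
       (S <#>\<^bsub>GL TYPE(bit) n\<^esub> S) \<inter> {x \<in> carrier (GL TYPE(bit) n). mat_supp x < m} = {})"
proof (intro exI[of _ 4] conjI allI impI)
  fix p :: "bit poly" and d m n :: nat and S :: "bit mat set"
  assume monic: "lead_coeff p = 1" and irr: "irreducible p" and deg: "degree p = d"
    and d3: "d \<ge> 3" and not_closed: "\<not> (\<forall>a \<in> ac_roots p. inverse a \<in> ac_roots p)"
    and m: "m \<ge> 1" and n: "n = d * m"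
    and S: "S = conj_class (GL TYPE(bit) n) (diag_block_mat (replicate m (companion_mat p)))"
  \<comment> \<open>This root serves both claims: it generates the field used to count the
    centralizer, and its inverse not being a root contradicts a product of small support.\<close>
  from not_closed obtain \<beta> where root: "poly (map_poly to_ac p) \<beta> = 0"
    and inv_root: "poly (map_poly to_ac p) (inverse \<beta>) \<noteq> 0"
    by (auto simp: ac_roots_def)
  interpret monic_irreducible_root p \<beta> d m
    by unfold_locales (fact irr deg root monic)+
  let ?R = "ring_mat TYPE(bit) n ()"
  interpret R: ring ?R by (rule ring_mat)
  have B: "B \<in> carrier ?R" using B_carrier by (simp add: ring_mat_simps n)
  have S_eq: "S = conj_class (units_of ?R) B"
    unfolding S GL_def B_def ..
  have C_eq: "C = {Y \<in> Units ?R. Y \<otimes>\<^bsub>?R\<^esub> B = B \<otimes>\<^bsub>?R\<^esub> Y}"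
    by (simp add: C_def ring_mat_simps n)
  have "card (Units ?R) = card S * card C"
    unfolding S_eq C_eq
    using card_Units_eq_conj_class_times_centralizer[OF R.monoid_axioms card_units_ring_mat(3) B] .
  \<comment> \<open>The centralizer exponent \<open>d * m * m\<close> is the group exponent
    \<open>n * n\<close> divided by \<open>d\<close>; this is the source of the term
    \<open>1 / real d\<close>.\<close>
  moreover have "d * (d * m * m) = n * n" by (simp add: n mult_ac)
  moreover have "n \<ge> 2"
    using mult_mono[OF d3 m] by (simp add: n)
  ultimately show "\<bar>ln (real (card S)) / ln (real (card (carrier (GL TYPE(bit) n)))) - (1 - 1 / real d)\<bar>
      \<le> 4 * real n powi (-2)"
    using card_units_ring_mat(1,2)[where 'a = bit and n = n] card_C_le card_C_ge d3
    unfolding GL_def units_of_carrier card_bit by (intro log_ratio_bound) auto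
  show "(S <#>\<^bsub>GL TYPE(bit) n\<^esub> S) \<inter> {x \<in> carrier (GL TYPE(bit) n). mat_supp x < m} = {}"
  proof (rule equals0I)
    fix x assume "x \<in> (S <#>\<^bsub>GL TYPE(bit) n\<^esub> S) \<inter> {x \<in> carrier (GL TYPE(bit) n). mat_supp x < m}"
    then obtain a b where ab: "a \<in> S" "b \<in> S" "x = a * b" and supp: "mat_supp x < m"
      by (auto simp: set_mult_def GL_def units_of_mult ring_mat_simps)
    from ab(1) obtain h where h: "h \<in> Units ?R" "a = h * B * inv\<^bsub>?R\<^esub> h"
      unfolding S_eq conj_class_units_of[OF R.monoid_axioms] by (auto simp: ring_mat_simps)
    from ab(2) obtain g where g: "g \<in> Units ?R" "b = g * B * inv\<^bsub>?R\<^esub> g"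
      unfolding S_eq conj_class_units_of[OF R.monoid_axioms] by (auto simp: ring_mat_simps)
    have unit: "y \<in> carrier_mat n n" "inv\<^bsub>?R\<^esub> y \<in> carrier_mat n n"
      "y * inv\<^bsub>?R\<^esub> y = 1\<^sub>m n" "inv\<^bsub>?R\<^esub> y * y = 1\<^sub>m n" if "y \<in> Units ?R" for y
      using that R.Units_closed[of y] R.Units_inv_closed[of y] R.Units_l_inv[of y] R.Units_r_inv[of y]
      by (simp_all add: ring_mat_simps)
    have "poly (map_poly to_ac p) (inverse \<beta>) = 0"
      by (rule inverse_root_of_small_support[OF monic deg d3 root n m B_def
            unit(1,2,4)[OF h(1)] unit[OF g(1)] _ supp])
        (simp add: ab(3) h(2) g(2))
    then show False using inv_root by simp
  qed
qed simp

end
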